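(* Consider the following four step sets in $\mathbb{Z}^2$: Model 1: $\{(1,0),(-1,0),(0,1),(0,-1)\}$; Model 2: $\{(1,1),(1,-1),(-1,1),(-1,-1)\}$; Model 3: $\{(0,1),(0,-1),(1,1),(1,-1),(-1,1),(-1,-1)\}$; Model 4: $\{-1,0,1\}^2\setminus\{(0,0)\}$. For each of these let $G(t;a,b)$ be the length generating function of quarter plane walks starting and ending at the origin, with weight $a$ per visit to the line $y=0$ and weight $b$ per visit to the line $x=0$. (i) For each of Models 1, 3 and 4: for general values of $a$ and $b$, $G(t;a,b)$ can be written as the ratio of two D-finite functions (of $t$); moreover $G(t;a,1)$ and $G(t;1,b)$ are D-finite. (ii) For Model 2, $G(t;a,b)$ is D-finite for all $a,b$.
   Context: Given a step set $\mathcal{S}\subseteq\{-1,0,1\}^2\setminus\{(0,0)\}$, a quarter plane walk of length $n$ is a walk in $\mathbb{Z}_{\ge 0}^2$ starting at $(0,0)$ and taking $n$ steps from $\mathcal{S}$, all of whose vertices lie in $\mathbb{Z}_{\ge0}^2$. Let $q_{n,k,\ell,h,v}$ be the number of such walks of length $n$ ending at $(k,\ell)$ which visit the horizontal boundary $y=0$ exactly $h$ times and the vertical boundary $x=0$ exactly $v$ times. The origin belongs to both boundaries, so a visit to the origin contributes $1$ to both $h$ and $v$ (weight $ab$). The starting vertex is not counted as a visit, so the empty walk has weight $1$. Define $$G(t;a,b)=\sum_{n\ge0}t^n\sum_{h,v\ge0}q_{n,0,0,h,v}\,a^hb^v\in\mathbb{Z}[a,b][[t]].$$ D-finite means: a formal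 series in $t$ which satisfies a non-trivial linear differential equation with respect to $t$ with polynomial coefficients in $t$. "General values of $a$ and $b$" means that $a,b$ are regarded as indeterminates, i.e. the base field of coefficients is $\mathbb{Q}(a,b)$ (so the polynomial coefficients lie in $\mathbb{Q}(a,b)[t]$, and similarly with $\mathbb{Q}(a)$ or $\mathbb{Q}(b)$ when only one variable is present). A ratio of two D-finite functions means $F/H$ with $F,H$ D-finite formal series in $t$ and $H\neq0$. "For all $a,b$" means with $a,b$ indeterminate as well as for every choice of complex numbers $a,b$ (with base field $\mathbb{C}$). *)

theory Defs
  imports
    Complex_Main
    "HOL-Library.Product_Plus"
    "HOL-Computational_Algebra.Computational_Algebra"
begin

definition model1 :: "(int \<times> int) set" where
  "model1 = {(1, 0), (-1, 0), (0, 1), (0, -1)}"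

definition model2 :: "(int \<times> int) set" where
  "model2 = {(1, 1), (1, -1), (-1, 1), (-1, -1)}"

definition model3 :: "(int \<times> int) set" where
  "model3 = {(0, 1), (0, -1), (1, 1), (1, -1), (-1, 1), (-1, -1)}"

definition model4 :: "(int \<times> int) set" where
  "model4 = {-1, 0, 1} \<times> {-1, 0, 1} - {(0, 0)}"

text \<open>A walk of length \<open>n\<close> is given by the list of its \<open>n + 1\<close> vertices.\<close>

definition quarter_plane_walks :: "(int \<times> int) set \<Rightarrow> nat \<Rightarrow> (int \<times> int) list set" where
  "quarter_plane_walks S n =
     {w. length w = Suc n \<and> w ! 0 = (0, 0) \<and>
         (\<forall>i<n. w ! Suc i - w ! i \<in> S) \<and>
         (\<forall>i\<le>n. 0 \<le> fst (w ! i) \<and> 0 \<le> snd (w ! i))}"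

text \<open>
  The starting vertex (index \<open>0\<close>) is not counted as a visit; a later visit to the
  origin counts as a visit to both boundaries.
\<close>

definition horizontal_visits :: "(int \<times> int) list \<Rightarrow> nat" where
  "horizontal_visits w = card {i. 1 \<le> i \<and> i < length w \<and> snd (w ! i) = 0}"

definition vertical_visits :: "(int \<times> int) list \<Rightarrow> nat" where
  "vertical_visits w = card {i. 1 \<le> i \<and> i < length w \<and> fst (w ! i) = 0}"

definition walk_count :: "(int \<times> int) set \<Rightarrow> nat \<Rightarrow> int \<Rightarrow> int \<Rightarrow> nat \<Rightarrow> nat \<Rightarrow> nat" where
  "walk_count S n k l h v =
     card {w \<in> quarter_plane_walks S n.
             w ! n = (k, l) \<and> horizontal_visits w = h \<and> vertical_visits w = v}"

text \<open>
  A walk of length \<open>n\<close> makes at most \<open>n\<close> visits to each boundary, so restricting the sums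
  over \<open>h\<close> and \<open>v\<close> to \<open>{..n}\<close> loses no terms. The weights may be indeterminates or numbers.
\<close>

definition walk_gf :: "(int \<times> int) set \<Rightarrow> 'k::comm_ring_1 \<Rightarrow> 'k \<Rightarrow> 'k fps" where
  "walk_gf S a b =
     Abs_fps (\<lambda>n. \<Sum>h\<le>n. \<Sum>v\<le>n. of_nat (walk_count S n 0 0 h v) * a ^ h * b ^ v)"

definition D_finite :: "'k::field fps \<Rightarrow> bool" where
  "D_finite F \<longleftrightarrow>
     (\<exists>(r::nat) p :: nat \<Rightarrow> 'k poly. (\<exists>i\<le>r. p i \<noteq> 0) \<and>
        (\<Sum>i\<le>r. fps_of_poly (p i) * (fps_deriv ^^ i) F) = 0)"

text \<open>
  The quotient is taken in the field of Laurent series, because division of formal power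
  series truncates when the denominator does not divide the numerator.
\<close>

definition D_finite_ratio :: "'k::field fps \<Rightarrow> bool" where
  "D_finite_ratio G \<longleftrightarrow>
     (\<exists>F H. D_finite F \<and> D_finite H \<and> H \<noteq> 0 \<and> fps_to_fls G = fps_to_fls F / fps_to_fls H)"

text \<open>
  The rational function field in one variable over the rationals is \<open>rat poly fract\<close>, with
  generator \<open>indet\<close>. The one in two variables is \<open>rat poly poly fract\<close>: the variable of the
  inner polynomials is \<open>indet_a\<close>, that of the outer ones is \<open>indet_b\<close>.
\<close>

definition indet :: "rat poly fract" where
  "indet = Fract [:0, 1:] 1"

definition indet_a :: "rat poly poly fract" where
  "indet_a = Fract [:[:0, 1:]:] 1"

definition indet_b :: "rat poly poly fract" where
  "indet_b = Fract [:0, 1:] 1"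

end

theory Submission
  imports Defs
begin

text \<open>
  Let \<open>\<alpha> = 1 - 1/a\<close> and \<open>\<beta> = 1 - 1/b\<close>. Dividing the step-by-step recurrence by the vertex weights
  shows that the walks ending at the points of the quadrant are counted by the first column of the
  inverse of an operator \<open>D - t S\<close>, where \<open>D\<close> is diagonal and equals \<open>(1 - \<beta> [i = 0]) (1 - \<alpha> [j = 0])\<close>.
  Up to a rank one term at the origin, a multiple of \<open>\<alpha> \<beta>\<close>, this column has an explicit form: a
  constant term (or residue) in an auxiliary variable \<open>z\<close> of an algebraic expression, found by the
  kernel method for Models 2, 3 and 4 and by separation of variables for Model 1. Because of the
  rank one term, \<open>G\<close> is a quotient of two linear functions of the value \<open>r\<close> at the origin; for Models 2
  and 3, and whenever \<open>\<alpha> \<beta> = 0\<close>, the denominator does not involve \<open>r\<close>. Finally, residues of algebraic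
  expressions are D-finite. Only square roots occur, so it is enough to treat sums of
  hyperexponential series, for which annihilating operators free of \<open>z\<close> exist by a dimension count.
\<close>

text \<open>The boundary weights separate in the two directions except at the origin, and this is
  where the rank one term comes from. For Models 2, 3 and 4 the step polynomial is a product minus
  \<open>th\<close>; with \<open>T = 1 + th t\<close> the separated solution has the diagonal entry
  \<open>(T - \<alpha>)(T - \<beta>)/T\<close> at the origin, while the walks require
  \<open>T - \<alpha> - \<beta> + \<alpha>\<beta>\<close>. The gap
  \<open>\<alpha>\<beta> th t / T\<close> vanishes for Models 2 and 3, where \<open>th = 0\<close>,
  but not for Model 4, where \<open>th = 1\<close>. For Model 1 the separated entry is
  \<open>1 - \<alpha> - \<beta>\<close> and the gap is \<open>\<alpha>\<beta>\<close>. In all cases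
  the gap is treated as a source at the origin that depends on the unknown value there. The solution
  for Model 1 divides by \<open>\<beta>\<close> and by a series with constant term
  \<open>1/a + 1/b - 1\<close>, whence the conditions \<open>b \<noteq> 1\<close> and
  \<open>1/a + 1/b \<noteq> 1\<close>. Indeterminate weights satisfy both; the weights
  \<open>(b, 1)\<close> are reduced to \<open>(1, b)\<close> by reflection.\<close>

unbundle fps_syntax

section \<open>Sums of hyperexponential series in two variables\<close>

text \<open>
  Elements of \<open>K((z))[[t]]\<close> have type \<open>'k fls fps\<close>: \<open>z\<close> is \<open>fps_const fls_X\<close> and \<open>t\<close> is \<open>fps_X\<close>.
\<close>

definition zt_scale :: "'k::field \<Rightarrow> 'k fls fps \<Rightarrow> 'k fls fps" where
  "zt_scale c f = fps_const (fls_const c) * f"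

definition dz :: "'k::field fls fps \<Rightarrow> 'k fls fps" where
  "dz f = Abs_fps (\<lambda>n. fls_deriv (f $ n))"

definition zcoeff :: "int \<Rightarrow> 'k::field fls fps \<Rightarrow> 'k fps" where
  "zcoeff k f = Abs_fps (\<lambda>n. (f $ n) $$ k)"

abbreviation zvar :: "'k::field fls fps" where "zvar \<equiv> fps_const fls_X"

definition ztmon :: "nat \<Rightarrow> nat \<Rightarrow> 'k::field fls fps" where
  "ztmon i j = zvar ^ i * fps_X ^ j"

text \<open>Scalars come from the ground field only. Powers of \<open>z\<close> and \<open>t\<close>
  thus count as different vectors, and polynomials of bounded degree form a space of finite
  dimension.\<close>

interpretation zt: vector_space "zt_scale :: 'k::field \<Rightarrow> 'k fls fps \<Rightarrow> 'k fls fps"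
  by unfold_locales
    (simp_all add: zt_scale_def algebra_simps flip: fls_plus_const fps_const_add fls_const_mult_const fps_const_mult)

lemma zt_scale_mult_left: "zt_scale c f * g = zt_scale c (f * g)"
  and zt_scale_mult_right: "f * zt_scale c g = zt_scale c (f * g)"
  by (simp_all add: zt_scale_def algebra_simps)

lemma dz_nth [simp]: "dz f $ n = fls_deriv (f $ n)"
  by (simp add: dz_def)

lemma dz_add [simp]: "dz (f + g) = dz f + dz g"
  by (rule fps_ext) simp

lemma dz_diff [simp]: "dz (f - g) = dz f - dz g"
  by (rule fps_ext) simp

lemma dz_0 [simp]: "dz 0 = 0"
  by (rule fps_ext) simp

lemma dz_mult: "dz (f * g) = dz f * g + f * dz g"
  by (rule fps_ext) (simp add: fps_mult_nth fls_deriv_sum sum.distrib add.commute)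

lemma dz_fps_const [simp]: "dz (fps_const c) = fps_const (fls_deriv c)"
  by (rule fps_ext) simp

lemma dz_fps_X [simp]: "dz fps_X = 0"
  by (rule fps_ext) (simp add: fps_X_def)

lemma dz_1 [simp]: "dz 1 = 0"
  by (rule fps_ext) simp

lemma dz_scale: "dz (zt_scale c f) = zt_scale c (dz f)"
  by (simp add: zt_scale_def dz_mult)

lemma dz_sum: "dz (sum f A) = (\<Sum>x\<in>A. dz (f x))"
  by (induction A rule: infinite_finite_induct) auto

lemma dz_fps_deriv: "dz (fps_deriv f) = fps_deriv (dz f)"
proof (rule fps_ext)
  fix n
  have "fls_deriv (of_nat m * g) = of_nat m * fls_deriv g" for m and g :: "'a fls"
    by (induction m) (simp_all add: algebra_simps)
  from this[of "Suc n" "f $ Suc n"] show "dz (fps_deriv f) $ n = fps_deriv (dz f) $ n"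
    by (simp del: of_nat_Suc)
qed

lemma deriv_scale: "fps_deriv (zt_scale c f) = zt_scale c (fps_deriv f)"
  by (simp add: zt_scale_def)

lemma zcoeff_nth [simp]: "zcoeff k f $ n = (f $ n) $$ k"
  by (simp add: zcoeff_def)

lemma zcoeff_add [simp]: "zcoeff k (f + g) = zcoeff k f + zcoeff k g"
  by (rule fps_ext) simp

lemma zcoeff_diff [simp]: "zcoeff k (f - g) = zcoeff k f - zcoeff k g"
  by (rule fps_ext) simp

lemma zcoeff_0 [simp]: "zcoeff k 0 = 0"
  by (rule fps_ext) simp

lemma zcoeff_sum: "zcoeff k (sum f A) = (\<Sum>x\<in>A. zcoeff k (f x))"
  by (induction A rule: infinite_finite_induct) auto

lemma zcoeff_scale: "zcoeff k (zt_scale c f) = fps_const c * zcoeff k f"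
  by (rule fps_ext) (simp add: zt_scale_def)

lemma zcoeff_X: "zcoeff k (fps_X * f) = fps_X * zcoeff k f"
  by (rule fps_ext) simp

lemma zcoeff_X_pow: "zcoeff k (fps_X ^ i * f) = fps_X ^ i * zcoeff k f"
  by (induction i) (simp_all add: zcoeff_X mult.assoc)

lemma zcoeff_deriv: "zcoeff k (fps_deriv f) = fps_deriv (zcoeff k f)"
proof (rule fps_ext)
  fix n
  have "(of_nat m * g) $$ k = of_nat m * (g $$ k)" for m and g :: "'a fls"
    by (induction m) (simp_all add: algebra_simps)
  from this[of "Suc n" "f $ Suc n"] show "zcoeff k (fps_deriv f) $ n = fps_deriv (zcoeff k f) $ n"
    by (simp del: of_nat_Suc)
qed

lemma zcoeff_deriv_pow: "zcoeff k ((fps_deriv ^^ j) f) = (fps_deriv ^^ j) (zcoeff k f)"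
  by (induction j) (simp_all add: zcoeff_deriv)

lemma zcoeff_dz: "zcoeff (-1) (dz f) = 0"
  by (rule fps_ext) simp

text \<open>Applying \<open>dz\<close> \<open>m\<close> times carries the coefficient of
  \<open>z^(-1)\<close> to that of \<open>z^(-1-m)\<close> with the factor \<open>(-1)^m m!\<close>,
  which is nonzero in characteristic 0.\<close>

lemma zcoeff_residue_if_dz_pow_eq_0:
  fixes f :: "'k::field_char_0 fls fps"
  assumes "(dz ^^ m) f = 0"
  shows "zcoeff (-1) f = 0"
proof -
  have nth: "((dz ^^ m) f $ n) $$ (- 1 - int m) = (- 1) ^ m * fact m * (f $ n $$ (- 1))" for n
  proof (induction m)
    case (Suc m)
    have "((dz ^^ Suc m) f $ n) $$ (- 1 - int (Suc m))
       = of_int (- 1 - int m) * ((dz ^^ m) f $ n) $$ (- 1 - int m)"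
      by simp
    also have "\<dots> = of_int (- 1 - int m) * ((- 1) ^ m * fact m * (f $ n $$ (- 1)))"
      by (simp only: Suc)
    finally show ?case
      by (simp add: algebra_simps)
  qed simp
  show ?thesis
    using nth assms by (intro fps_ext) auto
qed

section \<open>Polynomials in \<open>z\<close> and \<open>t\<close>, filtered by degree\<close>

definition bipolys :: "nat \<Rightarrow> 'k::field fls fps set" where
  "bipolys N = zt.span ((\<lambda>(i, j). ztmon i j) ` ({..N} \<times> {..N}))"

definition bipoly :: "'k::field fls fps \<Rightarrow> bool" where
  "bipoly f \<longleftrightarrow> (\<exists>N. f \<in> bipolys N)"

lemma bipolys_mono: "m \<le> n \<Longrightarrow> bipolys m \<subseteq> bipolys n"
  unfolding bipolys_def by (intro zt.span_mono) auto

lemma ztmon_in_bipolys: "i \<le> N \<Longrightarrow> j \<le> N \<Longrightarrow> ztmon i j \<in> bipolys N"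
  unfolding bipolys_def by (intro zt.span_base) auto

lemma bipolys_add: "f \<in> bipolys N \<Longrightarrow> g \<in> bipolys N \<Longrightarrow> f + g \<in> bipolys N"
  and bipolys_diff: "f \<in> bipolys N \<Longrightarrow> g \<in> bipolys N \<Longrightarrow> f - g \<in> bipolys N"
  and bipolys_0: "0 \<in> bipolys N"
  and bipolys_scale: "f \<in> bipolys N \<Longrightarrow> zt_scale c f \<in> bipolys N"
  unfolding bipolys_def
  by (auto intro: zt.span_add zt.span_diff zt.span_zero zt.span_scale)

lemma bipolys_induct [consumes 1, case_names zero add]:
  assumes "f \<in> bipolys N" "P 0"
    and "\<And>c i j g. i \<le> N \<Longrightarrow> j \<le> N \<Longrightarrow> P g \<Longrightarrow> P (zt_scale c (ztmon i j) + g)"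
  shows "P f"
  using assms(1) unfolding bipolys_def
  by (induction rule: zt.span_induct_alt) (use assms(2,3) in auto)

lemma ztmon_mult: "ztmon i j * ztmon i' j' = ztmon (i + i') (j + j')"
  by (simp add: ztmon_def power_add algebra_simps)

lemma bipolys_mult:
  assumes "f \<in> bipolys m" "g \<in> bipolys n"
  shows "f * g \<in> bipolys (m + n)"
  using assms(1)
proof (induction rule: bipolys_induct)
  case (add c i j f)
  have "ztmon i j * g \<in> bipolys (m + n)"
    using assms(2)
  proof (induction rule: bipolys_induct)
    case (add c' i' j' g)
    then show ?case
      using \<open>i \<le> m\<close> \<open>j \<le> m\<close>
      by (auto simp: ring_distribs zt_scale_mult_right ztmon_mult
          intro!: bipolys_add bipolys_scale ztmon_in_bipolys)
  qed (simp add: bipolys_0)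
  with add show ?case
    by (auto simp: ring_distribs zt_scale_mult_left intro!: bipolys_add bipolys_scale)
qed (simp add: bipolys_0)

lemma of_nat_eq_zt_scale: "of_nat n * f = zt_scale (of_nat n) f"
  by (metis fps_of_nat fls_of_nat zt_scale_def)

lemma dz_zvar_power: "dz (zvar ^ i) = of_nat i * zvar ^ (i - 1)"
proof (induction i)
  case (Suc i)
  have "dz (zvar ^ Suc i :: 'a fls fps) = zvar ^ i + zvar * (of_nat i * zvar ^ (i - 1))"
    using Suc by (simp add: dz_mult del: fps_const_power dz_fps_const) (simp del: fps_const_power)
  then show ?case
    by (cases i) (simp_all add: algebra_simps del: fps_const_power)
qed simp

lemma dz_fps_X_power [simp]: "dz (fps_X ^ j) = 0"
  by (induction j) (simp_all add: dz_mult)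

lemma dz_ztmon: "dz (ztmon i j) = zt_scale (of_nat i) (ztmon (i - 1) j)"
proof -
  have "dz (ztmon i j) = dz (zvar ^ i) * (fps_X ^ j :: 'a fls fps)"
    unfolding ztmon_def by (simp only: dz_mult dz_fps_X_power mult_zero_right add_0_right)
  also have "\<dots> = of_nat i * ztmon (i - 1) j"
    unfolding dz_zvar_power ztmon_def by (simp only: mult.assoc)
  finally show ?thesis
    by (simp only: of_nat_eq_zt_scale)
qed

lemma deriv_ztmon: "fps_deriv (ztmon i j) = zt_scale (of_nat j) (ztmon i (j - 1))"
proof -
  have "fps_deriv (ztmon i j) = of_nat j * (zvar ^ i * fps_X ^ (j - 1) :: 'a fls fps)"
    by (simp add: ztmon_def fps_deriv_power fps_of_nat mult_ac flip: fps_const_power)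
  then show ?thesis
    by (simp add: ztmon_def of_nat_eq_zt_scale)
qed

lemma bipolys_dz: "f \<in> bipolys N \<Longrightarrow> dz f \<in> bipolys N"
  by (induction rule: bipolys_induct)
    (auto simp: bipolys_0 dz_scale dz_ztmon intro!: bipolys_add bipolys_scale ztmon_in_bipolys)

lemma bipolys_deriv: "f \<in> bipolys N \<Longrightarrow> fps_deriv f \<in> bipolys N"
  by (induction rule: bipolys_induct)
    (auto simp: bipolys_0 deriv_scale deriv_ztmon intro!: bipolys_add bipolys_scale ztmon_in_bipolys)

lemma bipoly_0 [intro]: "bipoly 0"
  by (auto simp: bipoly_def bipolys_0)

lemma bipoly_ztmon: "bipoly (ztmon i j)"
  unfolding bipoly_def by (rule exI[of _ "max i j"]) (auto intro: ztmon_in_bipolys)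

lemma bipoly_1 [intro]: "bipoly 1"
  using bipoly_ztmon[of 0 0] by (simp add: ztmon_def)

lemma bipoly_X [intro]: "bipoly fps_X"
  using bipoly_ztmon[of 0 1] by (simp add: ztmon_def)

lemma bipoly_zvar [intro]: "bipoly zvar"
  using bipoly_ztmon[of 1 0] by (simp add: ztmon_def)

lemma bipoly_scale [intro]: "bipoly f \<Longrightarrow> bipoly (zt_scale c f)"
  by (auto simp: bipoly_def intro: bipolys_scale)

lemma bipoly_const [intro]: "bipoly (fps_const (fls_const c))"
  using bipoly_scale[OF bipoly_1] by (simp add: zt_scale_def)

lemma bipoly_numeral [intro]: "bipoly (numeral n)"
  using bipoly_const[of "numeral n"] by (simp add: numeral_fps_const)

lemma bipoly_add [intro]: assumes "bipoly f" "bipoly g" shows "bipoly (f + g)"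
proof -
  obtain m n where "f \<in> bipolys m" "g \<in> bipolys n"
    using assms by (auto simp: bipoly_def)
  then have "f + g \<in> bipolys (max m n)"
    using bipolys_mono[of m "max m n"] bipolys_mono[of n "max m n"] by (auto intro!: bipolys_add)
  then show ?thesis
    by (auto simp: bipoly_def)
qed

lemma bipoly_mult [intro]: "bipoly f \<Longrightarrow> bipoly g \<Longrightarrow> bipoly (f * g)"
  by (auto simp: bipoly_def intro: bipolys_mult)

lemma bipoly_minus [intro]: "bipoly f \<Longrightarrow> bipoly (- f)"
  using bipolys_diff[OF bipolys_0] by (force simp: bipoly_def)

lemma bipoly_diff [intro]: "bipoly f \<Longrightarrow> bipoly g \<Longrightarrow> bipoly (f - g)"
  using bipoly_add[of f "- g"] by auto

lemma bipoly_power [intro]: "bipoly f \<Longrightarrow> bipoly (f ^ n)"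
  by (induction n) auto

lemma bipoly_dz [intro]: "bipoly f \<Longrightarrow> bipoly (dz f)"
  by (auto simp: bipoly_def intro: bipolys_dz)

lemma bipoly_deriv [intro]: "bipoly f \<Longrightarrow> bipoly (fps_deriv f)"
  by (auto simp: bipoly_def intro: bipolys_deriv)

text \<open>Both logarithmic derivatives of \<open>e\<close> are rational in \<open>z\<close> and
  \<open>t\<close>. The multiplied-out form avoids dividing by \<open>e\<close>, so 0 is
  included.\<close>

definition hyperexp :: "'k::field fls fps \<Rightarrow> bool" where
  "hyperexp e \<longleftrightarrow> (\<exists>q A B. bipoly q \<and> q \<noteq> 0 \<and> bipoly A \<and> bipoly B \<and>
     q * dz e = A * e \<and> q * fps_deriv e = B * e)"

text \<open>The multiplier \<open>q\<close> makes the class closed under division by polynomials,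
  the list makes it closed under sums.\<close>

definition hyperexp_sum :: "'k::field fls fps \<Rightarrow> bool" where
  "hyperexp_sum f \<longleftrightarrow>
     (\<exists>q es. bipoly q \<and> q \<noteq> 0 \<and> (\<forall>e\<in>set es. hyperexp e) \<and> q * f = sum_list es)"

lemma hyperexp_bipoly: "bipoly f \<Longrightarrow> hyperexp f"
proof (cases "f = 0")
  case True
  then show ?thesis
    unfolding hyperexp_def by (intro exI[of _ 1] exI[of _ 0]) auto
next
  case False
  assume "bipoly f"
  with False show ?thesis
    unfolding hyperexp_def by (intro exI[of _ f] exI[of _ "dz f"] exI[of _ "fps_deriv f"]) auto
qed

lemma hyperexp_mult:
  assumes "hyperexp e" "hyperexp f"
  shows "hyperexp (e * f)"
proof -
  obtain q A B q' A' B' where q: "bipoly q" "q \<noteq> 0" "bipoly A" "bipoly B"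
      "q * dz e = A * e" "q * fps_deriv e = B * e"
    and q': "bipoly q'" "q' \<noteq> 0" "bipoly A'" "bipoly B'"
      "q' * dz f = A' * f" "q' * fps_deriv f = B' * f"
    using assms unfolding hyperexp_def by metis
  have "q * q' * dz (e * f) = (q * dz e) * q' * f + (q' * dz f) * q * e"
    by (simp add: dz_mult algebra_simps)
  also have "\<dots> = (A * q' + A' * q) * (e * f)"
    unfolding q q' by (simp add: algebra_simps)
  finally have 1: "q * q' * dz (e * f) = (A * q' + A' * q) * (e * f)" .
  have "q * q' * fps_deriv (e * f) = (q * fps_deriv e) * q' * f + (q' * fps_deriv f) * q * e"
    by (simp add: algebra_simps)
  also have "\<dots> = (B * q' + B' * q) * (e * f)"
    unfolding q q' by (simp add: algebra_simps)
  finally have 2: "q * q' * fps_deriv (e * f) = (B * q' + B' * q) * (e * f)" .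
  show ?thesis
    unfolding hyperexp_def using 1 2 q q'
    by (intro exI[of _ "q * q'"] exI[of _ "A * q' + A' * q"] exI[of _ "B * q' + B' * q"]) auto
qed

lemma two_neq_zero_zt: "(2 :: 'k::field_char_0 fls fps) \<noteq> 0"
  by (metis fps_const_eq_0_iff fls_const_eq_0_iff zero_neq_numeral numeral_fps_const fls_const_numeral)

text \<open>For either derivation \<open>2 s^2 s' = (s^2)' s\<close>, and \<open>s^2\<close> is a
  polynomial.\<close>

lemma hyperexp_sqrt:
  fixes s :: "'k::field_char_0 fls fps"
  assumes "bipoly (s ^ 2)"
  shows "hyperexp s"
proof (cases "s = 0")
  case False
  have "2 * s ^ 2 * dz s = dz (s ^ 2) * s" "2 * s ^ 2 * fps_deriv s = fps_deriv (s ^ 2) * s"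
    by (simp_all add: power2_eq_square dz_mult algebra_simps)
  moreover have "2 * s ^ 2 \<noteq> 0"
    using False two_neq_zero_zt by simp
  ultimately show ?thesis
    unfolding hyperexp_def using assms
    by (intro exI[of _ "2 * s ^ 2"] exI[of _ "dz (s ^ 2)"] exI[of _ "fps_deriv (s ^ 2)"]) auto
qed (simp add: hyperexp_bipoly bipoly_0)

lemma hyperexp_imp_sum: "hyperexp e \<Longrightarrow> hyperexp_sum e"
  unfolding hyperexp_sum_def by (intro exI[of _ 1] exI[of _ "[e]"]) auto

lemma hyperexp_sum_bipoly [intro]: "bipoly e \<Longrightarrow> hyperexp_sum e"
  by (intro hyperexp_imp_sum hyperexp_bipoly)

lemma hyperexp_sum_mult [intro]:
  assumes "hyperexp_sum f" "hyperexp_sum g"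
  shows "hyperexp_sum (f * g)"
proof -
  obtain q es r ds where q: "bipoly q" "q \<noteq> 0" "\<forall>e\<in>set es. hyperexp e" "q * f = sum_list es"
    and r: "bipoly r" "r \<noteq> 0" "\<forall>e\<in>set ds. hyperexp e" "r * g = sum_list ds"
    using assms unfolding hyperexp_sum_def by metis
  have "q * r * (f * g) = sum_list es * sum_list ds"
    by (simp add: mult_ac flip: q(4) r(4))
  also have "\<dots> = sum_list (concat (map (\<lambda>e. map (\<lambda>d. e * d) ds) es))"
    by (induction es) (simp_all add: algebra_simps sum_list_const_mult)
  finally show ?thesis
    unfolding hyperexp_sum_def using q r
    by (intro exI[of _ "q * r"] exI[of _ "concat (map (\<lambda>e. map (\<lambda>d. e * d) ds) es)"])
       (auto intro: hyperexp_mult)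
qed

lemma hyperexp_sum_cancel:
  assumes "hyperexp_sum (p * f)" "bipoly p" "p \<noteq> 0"
  shows "hyperexp_sum f"
proof -
  obtain q es where q: "bipoly q" "q \<noteq> 0" "\<forall>e\<in>set es. hyperexp e" "q * (p * f) = sum_list es"
    using assms(1) unfolding hyperexp_sum_def by metis
  then show ?thesis
    unfolding hyperexp_sum_def using assms(2,3)
    by (intro exI[of _ "q * p"] exI[of _ es]) (auto simp: mult.assoc)
qed

lemma hyperexp_sum_add [intro]:
  assumes "hyperexp_sum f" "hyperexp_sum g"
  shows "hyperexp_sum (f + g)"
proof -
  obtain q es r ds where q: "bipoly q" "q \<noteq> 0" "\<forall>e\<in>set es. hyperexp e" "q * f = sum_list es"
    and r: "bipoly r" "r \<noteq> 0" "\<forall>e\<in>set ds. hyperexp e" "r * g = sum_list ds"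
    using assms unfolding hyperexp_sum_def by metis
  have "q * r * (f + g) = r * sum_list es + q * sum_list ds"
    by (simp add: algebra_simps flip: q(4) r(4))
  also have "\<dots> = sum_list (map ((*) r) es @ map ((*) q) ds)"
    by (simp add: sum_list_const_mult)
  finally show ?thesis
    unfolding hyperexp_sum_def using q r
    by (intro exI[of _ "q * r"] exI[of _ "map ((*) r) es @ map ((*) q) ds"])
       (auto intro: hyperexp_mult hyperexp_bipoly)
qed

lemma hyperexp_sum_diff [intro]:
  assumes "hyperexp_sum f" "hyperexp_sum g"
  shows "hyperexp_sum (f - g)"
proof -
  have "hyperexp_sum (f + (- 1) * g)"
    using assms by blast
  then show ?thesis
    by simp
qed

lemma hyperexp_sum_power [intro]: "hyperexp_sum f \<Longrightarrow> hyperexp_sum (f ^ n)"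
  by (induction n) auto

lemma hyperexp_sum_quadratic:
  fixes f :: "'k::field_char_0 fls fps"
  assumes "bipoly a" "bipoly b" "bipoly c" and eq: "a * f ^ 2 + b * f + c = 0"
    and nz: "a \<noteq> 0 \<or> b \<noteq> 0"
  shows "hyperexp_sum f"
proof (cases "a = 0")
  case True
  with eq have "b * f = - c"
    by (simp add: eq_neg_iff_add_eq_0)
  then show ?thesis
    using hyperexp_sum_cancel[of b f] assms True by auto
next
  case False
  \<comment> \<open>Completing the square: \<open>2 a f + b\<close> is a square root of the
    discriminant.\<close>
  have "(2 * a * f + b) ^ 2 = 4 * a * (a * f ^ 2 + b * f + c) + (b ^ 2 - 4 * a * c)"
    by (simp add: power2_eq_square algebra_simps)
  with eq have "(2 * a * f + b) ^ 2 = b ^ 2 - 4 * a * c"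
    by simp
  with assms have "hyperexp (2 * a * f + b)"
    by (intro hyperexp_sqrt) auto
  then have "hyperexp_sum (2 * a * f + b - b)"
    using assms(2) by (intro hyperexp_sum_diff hyperexp_imp_sum[of "2 * a * f + b"] hyperexp_sum_bipoly)
  then have "hyperexp_sum (2 * a * f)"
    by (simp only: add_diff_cancel_right')
  moreover have "bipoly (2 * a)"
    using assms(1) by (intro bipoly_mult bipoly_numeral)
  moreover have "2 * a \<noteq> 0"
    using False two_neq_zero_zt by simp
  ultimately show ?thesis
    by (rule hyperexp_sum_cancel)
qed

text \<open>The relation is indexed by \<open>I\<close> and not by the set of vectors, so a repeated
  vector already gives one; otherwise the dimension bound applies.\<close>

lemma linear_relation_exists:
  fixes v :: "'i \<Rightarrow> 'k::field fls fps"
  assumes "finite I" "finite T" "v ` I \<subseteq> zt.span T" "card T < card I"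
  shows "\<exists>c. (\<exists>i\<in>I. c i \<noteq> 0) \<and> (\<Sum>i\<in>I. zt_scale (c i) (v i)) = 0"
proof (cases "inj_on v I")
  case True
  then have "card (v ` I) = card I"
    by (rule card_image)
  then have "zt.dependent (v ` I)"
    using zt.independent_span_bound[of T "v ` I"] assms by auto
  then obtain u where u: "\<exists>w\<in>v ` I. u w \<noteq> 0" "(\<Sum>w\<in>v ` I. zt_scale (u w) w) = 0"
    using zt.dependent_finite[of "v ` I"] assms by auto
  then show ?thesis
    using True by (intro exI[of _ "u \<circ> v"]) (auto simp: sum.reindex)
next
  case False
  then obtain i j where ij: "i \<in> I" "j \<in> I" "i \<noteq> j" "v i = v j"
    by (auto simp: inj_on_def)
  have "(\<Sum>k\<in>I. zt_scale (if k = i then 1 else if k = j then - 1 else 0) (v k))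
      = (\<Sum>k\<in>{i, j}. zt_scale (if k = i then 1 else if k = j then - 1 else 0) (v k))"
    using ij assms(1) by (intro sum.mono_neutral_right) auto
  also have "\<dots> = 0"
    using ij by simp
  finally show ?thesis
    using ij by (intro exI[of _ "\<lambda>k. if k = i then 1 else if k = j then - 1 else 0"]) auto
qed

lemma common_denominator:
  assumes "finite E" "\<forall>e\<in>E. hyperexp e"
  shows "\<exists>q. bipoly q \<and> q \<noteq> 0 \<and>
    (\<forall>e\<in>E. \<exists>A B. bipoly A \<and> bipoly B \<and> q * dz e = A * e \<and> q * fps_deriv e = B * e)"
  using assms
proof (induction E rule: finite_induct)
  case empty
  show ?case
    by (intro exI[of _ 1]) auto
next
  case (insert e E)
  obtain q where q: "bipoly q" "q \<noteq> 0"
    "\<And>d. d \<in> E \<Longrightarrow> \<exists>A B. bipoly A \<and> bipoly B \<and> q * dz d = A * d \<and> q * fps_deriv d = B * d"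
    using insert by auto
  obtain r A B where r: "bipoly r" "r \<noteq> 0" "bipoly A" "bipoly B"
      "r * dz e = A * e" "r * fps_deriv e = B * e"
    using insert.prems unfolding hyperexp_def by blast
  have "\<exists>A B. bipoly A \<and> bipoly B \<and> r * q * dz d = A * d \<and> r * q * fps_deriv d = B * d"
    if "d \<in> insert e E" for d
  proof (cases "d = e")
    case True
    have "r * q * dz e = q * A * e" "r * q * fps_deriv e = q * B * e"
      using r(5,6) by (simp_all add: mult_ac)
    then show ?thesis
      using True q r by (intro exI[of _ "q * A"] exI[of _ "q * B"] conjI bipoly_mult) simp_all
  next
    case False
    with that have "d \<in> E"
      by simp
    from q(3)[OF this] obtain A' B' where AB': "bipoly A'" "bipoly B'"
        "q * dz d = A' * d" "q * fps_deriv d = B' * d"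
      by (elim exE conjE)
    then have "r * q * dz d = r * A' * d" "r * q * fps_deriv d = r * B' * d"
      by (simp_all add: mult.assoc)
    then show ?thesis
      using AB' r by (intro exI[of _ "r * A'"] exI[of _ "r * B'"] conjI bipoly_mult)
  qed
  then have "\<forall>d\<in>insert e E. \<exists>A B. bipoly A \<and> bipoly B \<and>
      r * q * dz d = A * d \<and> r * q * fps_deriv d = B * d"
    by (rule ballI)
  moreover have "bipoly (r * q)" "r * q \<noteq> 0"
    using q(1,2) r(1,2) by (auto simp del: fps_const_mult)
  ultimately show ?case
    by (intro exI[of _ "r * q"] conjI)
qed

section \<open>Residues of sums of hyperexponential series are D-finite\<close>

lemma zt_span_mult_bipolys:
  assumes "c \<in> bipolys m" "h \<in> zt.span ((\<lambda>(i, j, e). ztmon i j * e) ` ({..n} \<times> {..n} \<times> E))"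
  shows "c * h \<in> zt.span ((\<lambda>(i, j, e). ztmon i j * e) ` ({..m + n} \<times> {..m + n} \<times> E))"
  using assms(1)
proof (induction rule: bipolys_induct)
  case (add d i j g)
  have "ztmon i j * h \<in> zt.span ((\<lambda>(i, j, e). ztmon i j * e) ` ({..m + n} \<times> {..m + n} \<times> E))"
    using assms(2)
  proof (induction rule: zt.span_induct_alt)
    case (step a x y)
    obtain k l e where x: "x = ztmon k l * e" "k \<le> n" "l \<le> n" "e \<in> E"
      using step by auto
    have "ztmon i j * x = ztmon (i + k) (j + l) * e"
      by (simp add: x ztmon_mult flip: mult.assoc)
    also have "\<dots> \<in> zt.span ((\<lambda>(i, j, e). ztmon i j * e) ` ({..m + n} \<times> {..m + n} \<times> E))"
      using x add by (intro zt.span_base image_eqI[of _ _ "(i + k, j + l, e)"]) auto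
    finally show ?case
      using step by (auto simp: ring_distribs zt_scale_mult_right intro: zt.span_add zt.span_scale)
  qed (simp add: zt.span_zero)
  with add show ?case
    by (auto simp: ring_distribs zt_scale_mult_left intro: zt.span_add zt.span_scale)
qed (simp add: zt.span_zero)

text \<open>One denominator \<open>q\<close> serves all of \<open>E\<close> and one \<open>d\<close>
  bounds all degrees. A derivation followed by multiplication with \<open>q\<close> then raises the
  degree bound in \<open>S\<close> by exactly \<open>d\<close>.\<close>

locale hyperexp_family =
  fixes q :: "'k::field_char_0 fls fps" and E :: "'k fls fps set" and d :: nat
  assumes fin: "finite E"
    and q_nz: "q \<noteq> 0" and q_bi: "q \<in> bipolys d"
    and ex: "e \<in> E \<Longrightarrow> \<exists>A\<in>bipolys d. \<exists>B\<in>bipolys d. q * dz e = A * e \<and> q * fps_deriv e = B * e"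
begin

definition S :: "nat \<Rightarrow> 'k fls fps set" where
  "S n = zt.span ((\<lambda>(i, j, e). ztmon i j * e) ` ({..n} \<times> {..n} \<times> E))"

lemma S_mult: "c \<in> bipolys m \<Longrightarrow> h \<in> S n \<Longrightarrow> c * h \<in> S (m + n)"
  unfolding S_def by (rule zt_span_mult_bipolys)

lemma S_base: "c \<in> bipolys n \<Longrightarrow> e \<in> E \<Longrightarrow> c * e \<in> S n"
proof -
  assume *: "c \<in> bipolys n" "e \<in> E"
  then have "ztmon 0 0 * e \<in> S 0"
    unfolding S_def by (intro zt.span_base image_eqI[of _ _ "(0, 0, e)"]) auto
  then show ?thesis
    using S_mult[OF *(1), of e 0] by (simp add: ztmon_def)
qed

lemma S_add: "g \<in> S n \<Longrightarrow> h \<in> S n \<Longrightarrow> g + h \<in> S n"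
  and S_diff: "g \<in> S n \<Longrightarrow> h \<in> S n \<Longrightarrow> g - h \<in> S n"
  and S_scale: "h \<in> S n \<Longrightarrow> zt_scale c h \<in> S n"
  and S_0: "0 \<in> S n"
  unfolding S_def by (auto intro: zt.span_add zt.span_diff zt.span_scale zt.span_zero)

lemma S_derivation:
  assumes D: "D = dz \<or> D = fps_deriv" and h: "h \<in> S n"
  shows "q * D h \<in> S (d + n)"
proof -
  have add: "D (f + g) = D f + D g" and mult: "D (f * g) = D f * g + f * D g"
    and scale: "D (zt_scale c f) = zt_scale c (D f)" and D0: "D 0 = 0"
    and bi: "f \<in> bipolys N \<Longrightarrow> D f \<in> bipolys N" for f g c N
    using D by (auto simp: dz_mult dz_scale deriv_scale bipolys_dz bipolys_deriv)
  show ?thesis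
    using h unfolding S_def
  proof (induction rule: zt.span_induct_alt)
    case base
    show ?case by (simp add: D0 zt.span_zero)
  next
    case (step a x y)
    obtain k l e where x: "x = ztmon k l * e" "k \<le> n" "l \<le> n" "e \<in> E"
      using step by auto
    obtain A where A: "A \<in> bipolys d" "q * D e = A * e"
      using ex[OF x(4)] D by auto
    have "q * D x = q * D (ztmon k l) * e + ztmon k l * (q * D e)"
      by (simp add: x mult algebra_simps)
    also have "\<dots> = (q * D (ztmon k l) + A * ztmon k l) * e"
      by (simp add: A algebra_simps)
    also have "\<dots> \<in> S (d + n)"
      using x A q_bi by (intro S_base bipolys_add bipolys_mult bi ztmon_in_bipolys) auto
    finally have "q * D x \<in> S (d + n)" .
    moreover have "q * D (zt_scale a x + y) = zt_scale a (q * D x) + q * D y"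
      by (simp add: add scale ring_distribs zt_scale_mult_right)
    ultimately show ?case
      using step unfolding S_def by (auto intro: zt.span_add zt.span_scale)
  qed
qed

text \<open>By the product rule,
  \<open>q^(m+2) D g = q D(q^(m+1) g) - (m+1) (D q) q^(m+1) g\<close>. Each further derivation costs
  one factor \<open>q\<close> and \<open>d\<close> degrees.\<close>

lemma derivation_step:
  assumes D: "D = dz \<or> D = fps_deriv" and g: "q ^ Suc m * g \<in> S n"
  shows "q ^ Suc (Suc m) * D g \<in> S (d + n)"
proof -
  have mult: "D (f * g) = D f * g + f * D g" and one: "D 1 = 0"
    and bi: "f \<in> bipolys N \<Longrightarrow> D f \<in> bipolys N" for f g N
    using D by (auto simp: dz_mult bipolys_dz bipolys_deriv)
  have pow: "q * D (q ^ k) = of_nat k * D q * q ^ k" for k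
  proof (induction k)
    case (Suc k)
    have "q * D (q ^ Suc k) = D q * q ^ Suc k + q * (q * D (q ^ k))"
      by (simp add: mult algebra_simps)
    then show ?case
      unfolding Suc by (simp add: algebra_simps)
  qed (simp add: one)
  have "q * D (q ^ Suc m * g) = (q * D (q ^ Suc m)) * g + q ^ Suc (Suc m) * D g"
    by (simp add: mult algebra_simps)
  also have "\<dots> = D q * zt_scale (of_nat (Suc m)) (q ^ Suc m * g) + q ^ Suc (Suc m) * D g"
    unfolding pow by (simp only: mult_ac flip: of_nat_eq_zt_scale)
  finally have "q ^ Suc (Suc m) * D g
      = q * D (q ^ Suc m * g) - D q * zt_scale (of_nat (Suc m)) (q ^ Suc m * g)"
    by simp
  also have "\<dots> \<in> S (d + n)"
    using g q_bi by (intro S_diff S_derivation[OF D] S_mult S_scale bi)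
  finally show ?thesis .
qed

lemma derivations_in_S:
  assumes "q * f \<in> S d"
  shows "q ^ Suc (j + k) * (fps_deriv ^^ j) ((dz ^^ k) f) \<in> S (Suc (j + k) * d)"
proof (induction j)
  case 0
  show ?case
  proof (induction k)
    case (Suc k)
    have "q ^ Suc (Suc k) * dz ((dz ^^ k) f) \<in> S (d + Suc k * d)"
      using Suc by (intro derivation_step) auto
    then show ?case
      by simp
  qed (use assms in simp)
next
  case (Suc j)
  have "q ^ Suc (Suc (j + k)) * fps_deriv ((fps_deriv ^^ j) ((dz ^^ k) f)) \<in> S (d + Suc (j + k) * d)"
    using Suc by (intro derivation_step) auto
  then show ?case
    by simp
qed

lemma card_generators: "card ((\<lambda>(i, j, e). ztmon i j * e) ` ({..n} \<times> {..n} \<times> E)) \<le> (n + 1)\<^sup>2 * card E"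
proof -
  have "card ((\<lambda>(i, j, e). ztmon i j * e) ` ({..n} \<times> {..n} \<times> E)) \<le> card ({..n} \<times> {..n} \<times> E)"
    using fin by (intro card_image_le) auto
  then show ?thesis
    by (simp add: power2_eq_square algebra_simps card_cartesian_product)
qed

text \<open>There are \<open>M^3\<close> monomials in \<open>t\<close> and the two derivations. Once
  \<open>q^(2M)\<close> clears the denominators, their values on \<open>f\<close> lie in a space
  whose dimension is only quadratic in \<open>M\<close>, because \<open>z\<close> and
  \<open>t\<close> are the only two variables of the coefficients.\<close>

lemma differential_relation:
  assumes f: "q * f \<in> S d"
  obtains M c where "\<exists>i<M. \<exists>j<M. \<exists>k<M. c i j k \<noteq> 0"
    "(\<Sum>(i, j, k)\<in>{..<M} \<times> {..<M} \<times> {..<M}.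
        zt_scale (c i j k) (fps_X ^ i * (fps_deriv ^^ j) ((dz ^^ k) f))) = 0"
proof -
  \<comment> \<open>With this \<open>M\<close>, the bound \<open>n + 1 \<le> (2 d + 2) M\<close>
    gives \<open>(n + 1)^2 card E \<le> M^2 (M - 1) < M^3\<close>.\<close>
  define M where "M = (2 * d + 2)\<^sup>2 * card E + 1"
  define n where "n = M + 2 * M * d"
  define I where "I = {..<M} \<times> {..<M} \<times> {..<M}"
  define v where "v = (\<lambda>(i, j, k). fps_X ^ i * (fps_deriv ^^ j) ((dz ^^ k) f))"
  have qpow: "q ^ r \<in> bipolys (r * d)" for r
  proof (induction r)
    case 0
    show ?case
      using ztmon_in_bipolys[of 0 0 0] by (simp add: ztmon_def)
  next
    case (Suc r)
    then show ?case
      using bipolys_mult[OF q_bi, of "q ^ r" "r * d"] by simp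
  qed
  have inS: "q ^ (2 * M) * v w \<in> S n" if w: "w \<in> I" for w
  proof -
    obtain i j k where [simp]: "w = (i, j, k)" and ijk: "i < M" "j < M" "k < M"
      using w by (auto simp: I_def)
    define r where "r = 2 * M - Suc (j + k)"
    have r: "2 * M = r + Suc (j + k)"
      using ijk by (simp add: r_def)
    have Xi: "fps_X ^ i \<in> bipolys M"
      using ijk ztmon_in_bipolys[of 0 M i] by (simp add: ztmon_def)
    have "q ^ (2 * M) * v w
        = fps_X ^ i * (q ^ r * (q ^ Suc (j + k) * (fps_deriv ^^ j) ((dz ^^ k) f)))"
      unfolding r power_add by (simp add: v_def mult_ac)
    also have "\<dots> \<in> S (M + (r * d + Suc (j + k) * d))"
      using f by (intro S_mult Xi qpow derivations_in_S)
    also have "M + (r * d + Suc (j + k) * d) = n"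
      unfolding n_def r by (simp add: algebra_simps)
    finally show ?thesis .
  qed
  have "(n + 1)\<^sup>2 * card E \<le> ((2 * d + 2) * M)\<^sup>2 * card E"
    by (intro mult_right_mono power_mono) (auto simp: n_def M_def algebra_simps)
  also have "\<dots> = M ^ 2 * ((2 * d + 2)\<^sup>2 * card E)"
    by (simp only: power_mult_distrib mult_ac)
  also have "\<dots> < M ^ 2 * M"
    by (simp add: M_def)
  also have "\<dots> = card I"
    by (simp add: I_def card_cartesian_product power2_eq_square)
  finally have "card ((\<lambda>(i, j, e). ztmon i j * e) ` ({..n} \<times> {..n} \<times> E)) < card I"
    using card_generators[of n] by linarith
  moreover have "(\<lambda>w. q ^ (2 * M) * v w) ` I \<subseteq> zt.span ((\<lambda>(i, j, e). ztmon i j * e) ` ({..n} \<times> {..n} \<times> E))"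
    using inS by (auto simp: S_def)
  moreover have "finite I" "finite ((\<lambda>(i, j, e). ztmon i j * e) ` ({..n} \<times> {..n} \<times> E))"
    using fin by (auto simp: I_def)
  ultimately have "\<exists>c. (\<exists>w\<in>I. c w \<noteq> 0) \<and> (\<Sum>w\<in>I. zt_scale (c w) (q ^ (2 * M) * v w)) = 0"
    by (intro linear_relation_exists)
  then obtain c where c: "\<exists>w\<in>I. c w \<noteq> 0" "(\<Sum>w\<in>I. zt_scale (c w) (q ^ (2 * M) * v w)) = 0"
    by (elim exE conjE)
  have "q ^ (2 * M) * (\<Sum>w\<in>I. zt_scale (c w) (v w)) = 0"
    using c(2) by (simp add: sum_distrib_left zt_scale_mult_right)
  then have "(\<Sum>w\<in>I. zt_scale (c w) (v w)) = 0"
    using q_nz by simp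
  then show ?thesis
    using c(1)
    by (intro that[of M "\<lambda>i j k. c (i, j, k)"])
       (auto simp: I_def v_def case_prod_unfold)
qed

end

lemma bipolys_bound:
  assumes "finite A" "\<forall>f\<in>A. bipoly f"
  shows "\<exists>d. A \<subseteq> bipolys d"
  using assms
proof (induction A rule: finite_induct)
  case (insert f A)
  then obtain m n where "A \<subseteq> bipolys m" "f \<in> bipolys n"
    by (auto simp: bipoly_def)
  then show ?case
    using bipolys_mono[of m "max m n"] bipolys_mono[of n "max m n"]
    by (intro exI[of _ "max m n"]) auto
qed auto

lemma dz_deriv_pow_commute: "(dz ^^ k) ((fps_deriv ^^ j) f) = (fps_deriv ^^ j) ((dz ^^ k) f)"
proof -
  have "dz ((fps_deriv ^^ j) g) = (fps_deriv ^^ j) (dz g)" for g :: "'a fls fps"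
    by (induction j) (simp_all add: dz_fps_deriv)
  then show ?thesis
    by (induction k) simp_all
qed

lemma dz_pow_linear:
  "(dz ^^ k) (zt_scale c (fps_X ^ i * f)) = zt_scale c (fps_X ^ i * (dz ^^ k) f)"
  by (induction k) (simp_all add: dz_scale dz_mult)

lemma dz_pow_sum: "(dz ^^ k) (sum f A) = (\<Sum>x\<in>A. (dz ^^ k) (f x))"
  by (induction k) (simp_all add: dz_sum)

text \<open>
  Zeilberger's argument: by comparing dimensions, \<open>f\<close> is annihilated by a differential
  operator in \<open>t\<close> and \<open>z\<close> whose coefficients do not involve \<open>z\<close>. After splitting off the
  largest power of the derivation in \<open>z\<close>, the residue only sees the part free of that derivation.
\<close>

theorem D_finite_residue:
  fixes f :: "'k::field_char_0 fls fps"
  assumes "hyperexp_sum f"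
  shows "D_finite (zcoeff (- 1) f)"
proof -
  obtain r es where r: "bipoly r" "r \<noteq> 0" "\<forall>e\<in>set es. hyperexp e" "r * f = sum_list es"
    using assms unfolding hyperexp_sum_def by blast
  obtain q where q: "bipoly q" "q \<noteq> 0"
      "\<forall>e\<in>set es. \<exists>A B. bipoly A \<and> bipoly B \<and> q * dz e = A * e \<and> q * fps_deriv e = B * e"
    using common_denominator[of "set es"] r(3) by auto
  obtain A B where AB: "\<And>e. e \<in> set es \<Longrightarrow> bipoly (A e) \<and> bipoly (B e) \<and>
      q * dz e = A e * e \<and> q * fps_deriv e = B e * e"
    using q(3) by metis
  have "\<forall>f\<in>{q, r * q} \<union> (\<lambda>e. r * A e) ` set es \<union> (\<lambda>e. r * B e) ` set es. bipoly f"
    using q(1) r(1) AB by (auto intro!: bipoly_mult)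
  from bipolys_bound[OF _ this] obtain d
    where d: "{q, r * q} \<union> (\<lambda>e. r * A e) ` set es \<union> (\<lambda>e. r * B e) ` set es \<subseteq> bipolys d"
    by auto
  interpret hyperexp_family "r * q" "set es" d
  proof
    fix e assume "e \<in> set es"
    with AB[of e] d show "\<exists>A\<in>bipolys d. \<exists>B\<in>bipolys d. r * q * dz e = A * e \<and> r * q * fps_deriv e = B * e"
      by (intro bexI[of _ "r * A e"] bexI[of _ "r * B e"]) (auto simp: mult.assoc)
  qed (use q r d in auto)
  have "q * sum_list ds \<in> S d" if "set ds \<subseteq> set es" for ds
    using that d by (induction ds) (auto simp: S_0 ring_distribs intro!: S_add S_base)
  moreover have "r * q * f = q * sum_list es"
    by (simp only: r(4)[symmetric] mult_ac)
  ultimately have "r * q * f \<in> S d"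
    by (metis subset_refl)
  then obtain M c where nz: "\<exists>i<M. \<exists>j<M. \<exists>k<M. c i j k \<noteq> 0" and
    rel: "(\<Sum>(i, j, k)\<in>{..<M} \<times> {..<M} \<times> {..<M}.
        zt_scale (c i j k) (fps_X ^ i * (fps_deriv ^^ j) ((dz ^^ k) f))) = 0"
    by (rule differential_relation)
  define m where "m = (LEAST k. k < M \<and> (\<exists>i<M. \<exists>j<M. c i j k \<noteq> 0))"
  have m: "m < M" "\<exists>i<M. \<exists>j<M. c i j m \<noteq> 0"
    using LeastI_ex[of "\<lambda>k. k < M \<and> (\<exists>i<M. \<exists>j<M. c i j k \<noteq> 0)"] nz unfolding m_def by blast+
  have least: "c i j k = 0" if "k < m" "i < M" "j < M" for i j k
    using not_less_Least[of k "\<lambda>k. k < M \<and> (\<exists>i<M. \<exists>j<M. c i j k \<noteq> 0)"] that m(1)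
    unfolding m_def by force
  define g where "g = (\<Sum>k\<in>{m..<M}. \<Sum>i<M. \<Sum>j<M.
        zt_scale (c i j k) (fps_X ^ i * (dz ^^ (k - m)) ((fps_deriv ^^ j) f)))"
  have dz_add: "(dz ^^ m) ((dz ^^ (k - m)) h) = (dz ^^ k) h" if "m \<le> k" for k h
    using that funpow_add[of m "k - m" dz] by (metis comp_apply le_add_diff_inverse)
  have "(dz ^^ m) g = (\<Sum>k\<in>{m..<M}. \<Sum>i<M. \<Sum>j<M.
        zt_scale (c i j k) (fps_X ^ i * (fps_deriv ^^ j) ((dz ^^ k) f)))"
    unfolding g_def dz_pow_sum
    by (intro sum.cong refl) (simp add: dz_pow_linear dz_add dz_deriv_pow_commute)
  also have "\<dots> = (\<Sum>k<M. \<Sum>i<M. \<Sum>j<M.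
        zt_scale (c i j k) (fps_X ^ i * (fps_deriv ^^ j) ((dz ^^ k) f)))"
    by (intro sum.mono_neutral_left) (auto simp: least intro!: sum.neutral)
  also have "\<dots> = (\<Sum>i<M. \<Sum>k<M. \<Sum>j<M.
        zt_scale (c i j k) (fps_X ^ i * (fps_deriv ^^ j) ((dz ^^ k) f)))"
    by (rule sum.swap)
  also have "\<dots> = (\<Sum>i<M. \<Sum>j<M. \<Sum>k<M.
        zt_scale (c i j k) (fps_X ^ i * (fps_deriv ^^ j) ((dz ^^ k) f)))"
    by (intro sum.cong refl sum.swap)
  also have "\<dots> = 0"
    using rel by (simp add: sum.cartesian_product)
  finally have res_g: "zcoeff (- 1) g = 0"
    by (rule zcoeff_residue_if_dz_pow_eq_0)
  have res_dz: "zcoeff (- 1) ((dz ^^ (k - m)) h) = (if k = m then zcoeff (- 1) h else 0)"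
    if "k \<ge> m" for k h
  proof (cases "k = m")
    case False
    with that obtain l where "k - m = Suc l"
      by (metis diff_is_0_eq le_antisym old.nat.exhaust)
    with False show ?thesis
      by (simp add: zcoeff_dz)
  qed simp
  have "(\<Sum>k\<in>{m..<M}. \<Sum>i<M. \<Sum>j<M. fps_const (c i j k) *
      (fps_X ^ i * zcoeff (- 1) ((dz ^^ (k - m)) ((fps_deriv ^^ j) f)))) = 0"
    using res_g by (simp add: g_def zcoeff_sum zcoeff_scale zcoeff_X_pow)
  also have "(\<Sum>k\<in>{m..<M}. \<Sum>i<M. \<Sum>j<M. fps_const (c i j k) *
      (fps_X ^ i * zcoeff (- 1) ((dz ^^ (k - m)) ((fps_deriv ^^ j) f)))) =
      (\<Sum>k\<in>{m..<M}. \<Sum>i<M. \<Sum>j<M. fps_const (c i j k) *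
      (fps_X ^ i * (if k = m then (fps_deriv ^^ j) (zcoeff (- 1) f) else 0)))"
    by (intro sum.cong refl) (simp add: res_dz zcoeff_deriv_pow)
  also have "(\<Sum>k\<in>{m..<M}. \<Sum>i<M. \<Sum>j<M. fps_const (c i j k) *
      (fps_X ^ i * (if k = m then (fps_deriv ^^ j) (zcoeff (- 1) f) else 0))) =
      (\<Sum>k\<in>{m}. \<Sum>i<M. \<Sum>j<M. fps_const (c i j k) *
      (fps_X ^ i * (if k = m then (fps_deriv ^^ j) (zcoeff (- 1) f) else 0)))"
    using m(1) by (intro sum.mono_neutral_right) auto
  finally have "(\<Sum>i<M. \<Sum>j<M. fps_const (c i j m) * fps_X ^ i * (fps_deriv ^^ j) (zcoeff (- 1) f)) = 0"
    by (simp add: mult.assoc)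
  then have eq: "(\<Sum>j<M. (\<Sum>i<M. fps_const (c i j m) * fps_X ^ i) * (fps_deriv ^^ j) (zcoeff (- 1) f)) = 0"
    unfolding sum_distrib_right by (subst sum.swap)
  define P where "P j = (\<Sum>i<M. monom (c i j m) i)" for j
  have P: "fps_of_poly (P j) = (\<Sum>i<M. fps_const (c i j m) * fps_X ^ i)" for j
    by (simp add: P_def fps_of_poly_sum fps_of_poly_monom)
  have coeff_P: "coeff (P j) i = (if i < M then c i j m else 0)" for i j
    by (simp add: P_def coeff_sum sum.delta)
  obtain i j where ij: "i < M" "j < M" "c i j m \<noteq> 0"
    using m(2) by blast
  then have "P j \<noteq> 0"
    using coeff_P[of j i] by auto
  moreover have "{..M - 1} = {..<M}"
    using m(1) by auto
  ultimately show ?thesis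
    unfolding D_finite_def using ij eq
    by (intro exI[of _ "M - 1"] exI[of _ P]) (auto simp: P)
qed

section \<open>Weighted walks and their recurrence\<close>

definition walks_to :: "(int \<times> int) set \<Rightarrow> nat \<Rightarrow> int \<times> int \<Rightarrow> (int \<times> int) list set" where
  "walks_to S n p = {w \<in> quarter_plane_walks S n. w ! n = p}"

definition quadrant :: "(int \<times> int) set" where
  "quadrant = {p. 0 \<le> fst p \<and> 0 \<le> snd p}"

definition vertex_weight :: "'k::comm_ring_1 \<Rightarrow> 'k \<Rightarrow> int \<times> int \<Rightarrow> 'k" where
  "vertex_weight a b p = (if snd p = 0 then a else 1) * (if fst p = 0 then b else 1)"

definition walk_weight :: "(int \<times> int) set \<Rightarrow> 'k::comm_ring_1 \<Rightarrow> 'k \<Rightarrow> nat \<Rightarrow> int \<times> int \<Rightarrow> 'k" where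
  "walk_weight S a b n p = (\<Sum>w\<in>walks_to S n p. a ^ horizontal_visits w * b ^ vertical_visits w)"

lemma walks_to_0: "walks_to S 0 p = (if p = (0, 0) then {[(0, 0)]} else {})"
  by (auto simp: walks_to_def quarter_plane_walks_def length_Suc_conv)

lemma walks_to_Suc:
  "walks_to S (Suc n) p =
     (if p \<in> quadrant then (\<Union>s\<in>S. (\<lambda>w. w @ [p]) ` walks_to S n (p - s)) else {})"
proof (intro Set.set_eqI iffI)
  fix w assume "w \<in> walks_to S (Suc n) p"
  then have w: "length w = Suc (Suc n)" "w ! 0 = (0, 0)" "w ! Suc n = p"
      "\<And>i. i < Suc n \<Longrightarrow> w ! Suc i - w ! i \<in> S" "\<And>i. i \<le> Suc n \<Longrightarrow> w ! i \<in> quadrant"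
    by (auto simp: walks_to_def quarter_plane_walks_def quadrant_def)
  define w' where "w' = butlast w"
  have w': "w = w' @ [p]"
    using w(1,3) unfolding w'_def by (metis append_butlast_last_id diff_Suc_1 last_conv_nth list.size(3) nat.distinct(1))
  then have len: "length w' = Suc n"
    using w(1) by simp
  have nth: "w' ! i = w ! i" if "i \<le> n" for i
    using that len by (simp add: w' nth_append)
  define s where "s = p - w' ! n"
  have "s \<in> S"
    using w(4)[of n] w(3) nth[of n] by (simp add: s_def)
  moreover have "w' \<in> walks_to S n (p - s)"
    unfolding walks_to_def quarter_plane_walks_def mem_Collect_eq
  proof (intro conjI allI impI)
    show "length w' = Suc n"
      by (rule len)
    show "w' ! 0 = (0, 0)"
      using w(2) nth[of 0] by simp
    show "w' ! n = p - s"
      by (simp add: s_def)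
    show "w' ! Suc i - w' ! i \<in> S" if "i < n" for i
      using w(4)[of i] nth[of i] nth[of "Suc i"] that by simp
    show "0 \<le> fst (w' ! i)" "0 \<le> snd (w' ! i)" if "i \<le> n" for i
      using w(5)[of i] nth[of i] that by (auto simp: quadrant_def)
  qed
  moreover have "p \<in> quadrant"
    using w(5)[of "Suc n"] w(3) by simp
  ultimately show "w \<in> (if p \<in> quadrant then (\<Union>s\<in>S. (\<lambda>w. w @ [p]) ` walks_to S n (p - s)) else {})"
    using w' by auto
next
  fix w assume "w \<in> (if p \<in> quadrant then (\<Union>s\<in>S. (\<lambda>w. w @ [p]) ` walks_to S n (p - s)) else {})"
  then obtain s w' where *: "p \<in> quadrant" "s \<in> S" "w' \<in> walks_to S n (p - s)" "w = w' @ [p]"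
    by (auto split: if_splits)
  then have w': "length w' = Suc n" "w' ! 0 = (0, 0)" "w' ! n = p - s"
      "\<And>i. i < n \<Longrightarrow> w' ! Suc i - w' ! i \<in> S" "\<And>i. i \<le> n \<Longrightarrow> w' ! i \<in> quadrant"
    by (auto simp: walks_to_def quarter_plane_walks_def quadrant_def)
  have nth: "w ! i = (if i \<le> n then w' ! i else p)" if "i \<le> Suc n" for i
    using that w'(1) by (auto simp: * nth_append not_le)
  have "w ! Suc i - w ! i \<in> S" if "i < Suc n" for i
    using that w'(3,4) *(2) by (cases "i = n") (auto simp: nth)
  moreover have "w ! i \<in> quadrant" if "i \<le> Suc n" for i
    using that w'(5) *(1) by (auto simp: nth)
  moreover have "length w = Suc (Suc n)" "w ! 0 = (0, 0)" "w ! Suc n = p"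
    using w'(1,2) *(4) nth[of 0] nth[of "Suc n"] by simp_all
  ultimately show "w \<in> walks_to S (Suc n) p"
    by (auto simp: walks_to_def quarter_plane_walks_def quadrant_def)
qed

lemma finite_walks_to: "finite S \<Longrightarrow> finite (walks_to S n p)"
  by (induction n arbitrary: p) (auto simp: walks_to_0 walks_to_Suc)

text \<open>The new vertex has index \<open>length w\<close>. Since index 0 is not counted as a
  visit, \<open>w\<close> has to be nonempty for it to count.\<close>

lemma card_visits_snoc:
  assumes "w \<noteq> []"
  shows "card {i. 1 \<le> i \<and> i < length (w @ [p]) \<and> P ((w @ [p]) ! i)}
       = card {i. 1 \<le> i \<and> i < length w \<and> P (w ! i)} + (if P p then 1 else 0)"
proof -
  have "{i. 1 \<le> i \<and> i < length (w @ [p]) \<and> P ((w @ [p]) ! i)}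
      = {i. 1 \<le> i \<and> i < length w \<and> P (w ! i)} \<union> (if P p then {length w} else {})"
    using assms by (auto simp: nth_append less_Suc_eq Suc_le_eq split: if_splits)
  then show ?thesis
    by (simp add: card_insert_if)
qed

lemma visits_snoc:
  assumes "w \<noteq> []"
  shows "horizontal_visits (w @ [p]) = horizontal_visits w + (if snd p = 0 then 1 else 0)"
    and "vertical_visits (w @ [p]) = vertical_visits w + (if fst p = 0 then 1 else 0)"
  unfolding horizontal_visits_def vertical_visits_def
  using card_visits_snoc[OF assms, of p "\<lambda>q. snd q = 0"]
    card_visits_snoc[OF assms, of p "\<lambda>q. fst q = 0"] by auto

lemma visits_le:
  assumes "w \<in> walks_to S n p"
  shows "horizontal_visits w \<le> n" "vertical_visits w \<le> n"
proof -
  have "card {i. 1 \<le> i \<and> i < length w \<and> P i} \<le> card {1..n}" for P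
    using assms by (intro card_mono) (auto simp: walks_to_def quarter_plane_walks_def)
  then show "horizontal_visits w \<le> n" "vertical_visits w \<le> n"
    unfolding horizontal_visits_def vertical_visits_def by simp_all
qed

lemma walk_weight_0: "walk_weight S a b 0 p = (if p = (0, 0) then 1 else 0)"
proof -
  have "horizontal_visits [(0, 0)] = 0" "vertical_visits [(0, 0)] = 0"
    by (auto simp: horizontal_visits_def vertical_visits_def card_eq_0_iff)
  then show ?thesis
    by (simp add: walk_weight_def walks_to_0)
qed

lemma walk_weight_Suc:
  assumes "finite S"
  shows "walk_weight S a b (Suc n) p =
    (if p \<in> quadrant then vertex_weight a b p * (\<Sum>s\<in>S. walk_weight S a b n (p - s)) else 0)"
proof (cases "p \<in> quadrant")
  case True
  have disj: "(\<lambda>w. w @ [p]) ` walks_to S n (p - s) \<inter> (\<lambda>w. w @ [p]) ` walks_to S n (p - s') = {}"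
    if "s \<noteq> s'" for s s'
    using that by (auto simp: walks_to_def)
  have "walk_weight S a b (Suc n) p = (\<Sum>s\<in>S. \<Sum>w\<in>(\<lambda>w. w @ [p]) ` walks_to S n (p - s).
      a ^ horizontal_visits w * b ^ vertical_visits w)"
    using True assms disj unfolding walk_weight_def walks_to_Suc
    by (subst if_P, simp, intro sum.UNION_disjoint) (auto intro: finite_walks_to)
  also have "\<dots> = (\<Sum>s\<in>S. \<Sum>w\<in>walks_to S n (p - s).
      vertex_weight a b p * (a ^ horizontal_visits w * b ^ vertical_visits w))"
  proof (rule sum.cong[OF refl])
    fix s
    have "inj_on (\<lambda>w. w @ [p]) (walks_to S n (p - s))"
      by (auto simp: inj_on_def)
    moreover have "w \<noteq> []" if "w \<in> walks_to S n (p - s)" for w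
      using that by (auto simp: walks_to_def quarter_plane_walks_def)
    ultimately show "(\<Sum>w\<in>(\<lambda>w. w @ [p]) ` walks_to S n (p - s).
      a ^ horizontal_visits w * b ^ vertical_visits w) = (\<Sum>w\<in>walks_to S n (p - s).
      vertex_weight a b p * (a ^ horizontal_visits w * b ^ vertical_visits w))"
      by (simp add: sum.reindex visits_snoc vertex_weight_def mult_ac cong: sum.cong)
  qed
  finally show ?thesis
    using True by (simp add: walk_weight_def sum_distrib_left)
qed (simp add: walk_weight_def walks_to_Suc)

lemma walk_gf_nth:
  assumes "finite S"
  shows "walk_gf S a b $ n = walk_weight S a b n (0, 0)"
proof -
  let ?W = "walks_to S n (0, 0)"
  let ?f = "\<lambda>w. a ^ horizontal_visits w * b ^ vertical_visits w"
  have count: "walk_count S n 0 0 h v = card {w \<in> ?W. (horizontal_visits w, vertical_visits w) = (h, v)}" for h v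
    unfolding walk_count_def by (intro arg_cong[of _ _ card]) (auto simp: walks_to_def)
  have "walk_gf S a b $ n = (\<Sum>(h, v)\<in>{..n} \<times> {..n}. of_nat (walk_count S n 0 0 h v) * a ^ h * b ^ v)"
    by (simp add: walk_gf_def sum.cartesian_product)
  also have "\<dots> = (\<Sum>y\<in>{..n} \<times> {..n}. \<Sum>w\<in>{w \<in> ?W. (horizontal_visits w, vertical_visits w) = y}. ?f w)"
  proof (intro sum.cong refl)
    fix y :: "nat \<times> nat"
    obtain h v where y: "y = (h, v)"
      by (cases y)
    have "(\<Sum>w\<in>{w \<in> ?W. (horizontal_visits w, vertical_visits w) = (h, v)}. ?f w)
        = (\<Sum>w\<in>{w \<in> ?W. (horizontal_visits w, vertical_visits w) = (h, v)}. a ^ h * b ^ v)"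
      by (intro sum.cong) auto
    then show "(case y of (h, v) \<Rightarrow> of_nat (walk_count S n 0 0 h v) * a ^ h * b ^ v)
        = (\<Sum>w\<in>{w \<in> ?W. (horizontal_visits w, vertical_visits w) = y}. ?f w)"
      by (simp only: y count prod.case sum_constant mult.assoc)
  qed
  also have "\<dots> = (\<Sum>w\<in>?W. ?f w)"
    by (intro sum.group) (auto simp: finite_walks_to assms visits_le)
  finally show ?thesis
    by (simp add: walk_weight_def)
qed

text \<open>Needed for Model 1, whose explicit solution treats the two weights differently and
  requires \<open>b \<noteq> 1\<close>.\<close>

lemma walk_gf_swap:
  assumes "finite S" and sym: "prod.swap ` S = S"
  shows "walk_gf S a b = walk_gf S b a"
proof -
  have "walk_weight S a b n p = walk_weight S b a n (prod.swap p)" for n p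
  proof (induction n arbitrary: p)
    case (Suc n)
    have "(\<Sum>s\<in>S. walk_weight S b a n (prod.swap p - s))
        = (\<Sum>s\<in>prod.swap ` S. walk_weight S b a n (prod.swap p - s))"
      using sym by simp
    also have "\<dots> = (\<Sum>s\<in>S. walk_weight S b a n (prod.swap (p - s)))"
      by (subst sum.reindex) (auto simp: inj_on_def prod_eq_iff intro!: sum.cong arg_cong[of _ _ "walk_weight S b a n"])
    finally show ?case
      using Suc assms(1) by (auto simp: walk_weight_Suc vertex_weight_def quadrant_def mult_ac)
  qed (auto simp: walk_weight_0)
  from this[of _ "(0, 0)"] show ?thesis
    by (intro fps_ext) (simp add: walk_gf_nth assms(1))
qed

text \<open>The last vertex of a nonempty walk to the origin has weight \<open>a b = 0\<close>, so
  only the empty walk remains. This covers the weights for which \<open>1/a\<close> or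
  \<open>1/b\<close> makes no sense.\<close>

lemma walk_gf_eq_1:
  assumes "finite S" "a = 0 \<or> b = 0"
  shows "walk_gf S a b = 1"
proof (rule fps_ext)
  fix n show "walk_gf S a b $ n = 1 $ n"
    using assms by (cases n) (auto simp: walk_gf_nth walk_weight_0 walk_weight_Suc vertex_weight_def)
qed

text \<open>Apart from the source \<open>C\<close>, every term of the recurrence has a factor
  \<open>t\<close>, so the difference of two solutions vanishes order by order. The series
  \<open>C\<close> is arbitrary and may involve \<open>R (0, 0)\<close> itself; the rank one term is
  absorbed in this way.\<close>

lemma walk_gf_unique:
  fixes a b :: "'k::field" and R :: "int \<times> int \<Rightarrow> 'k fps"
  assumes S: "finite S"
    and R_out: "\<And>p. p \<notin> quadrant \<Longrightarrow> R p = 0"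
    and R_in: "\<And>p. p \<in> quadrant \<Longrightarrow> R p = (if p = (0, 0) then C else 0) +
          fps_const (vertex_weight a b p) * fps_X * (\<Sum>s\<in>S. R (p - s))"
  shows "R (0, 0) = C * walk_gf S a b"
proof -
  define Q where "Q p = Abs_fps (\<lambda>n. walk_weight S a b n p)" for p
  have Q_out: "Q p = 0" if "p \<notin> quadrant" for p
  proof (rule fps_ext)
    fix n show "Q p $ n = 0 $ n"
      using that by (cases n) (auto simp: Q_def walk_weight_0 walk_weight_Suc S quadrant_def)
  qed
  have Q_in: "Q p = (if p = (0, 0) then 1 else 0) +
          fps_const (vertex_weight a b p) * fps_X * (\<Sum>s\<in>S. Q (p - s))" if "p \<in> quadrant" for p
  proof (rule fps_ext)
    fix n show "Q p $ n = ((if p = (0, 0) then 1 else 0) +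
          fps_const (vertex_weight a b p) * fps_X * (\<Sum>s\<in>S. Q (p - s))) $ n"
      using that by (cases n) (auto simp: Q_def walk_weight_0 walk_weight_Suc S mult.assoc fps_sum_nth)
  qed
  define D where "D p = R p - C * Q p" for p
  have D_out: "D p = 0" if "p \<notin> quadrant" for p
    using that by (simp add: D_def R_out Q_out)
  have D_in: "D p = fps_const (vertex_weight a b p) * (fps_X * (\<Sum>s\<in>S. D (p - s)))"
    if p: "p \<in> quadrant" for p
    unfolding D_def
    by (subst R_in[OF p], subst Q_in[OF p]) (simp add: sum_subtractf sum_distrib_left algebra_simps)
  have "D p $ n = 0" for n p
  proof (induction n arbitrary: p)
    case 0
    show ?case
      using D_in[of p] D_out[of p] by (cases "p \<in> quadrant") simp_all
  next
    case (Suc n)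
    have "D p $ Suc n = vertex_weight a b p * (\<Sum>s\<in>S. D (p - s) $ n)" if "p \<in> quadrant"
      by (subst D_in[OF that]) (simp add: fps_sum_nth)
    with Suc show ?case
      using D_out[of p] by (cases "p \<in> quadrant") simp_all
  qed
  then have "D (0, 0) = 0"
    by (intro fps_ext) simp
  moreover have "Q (0, 0) = walk_gf S a b"
    by (intro fps_ext) (simp add: Q_def walk_gf_nth S)
  ultimately show ?thesis
    by (simp add: D_def)
qed

section \<open>Extracting coefficients in the auxiliary variable\<close>

text \<open>Series in \<open>t\<close> viewed as constants in \<open>z\<close>; extraction of
  coefficients in \<open>z\<close> is linear over them.\<close>

definition lift :: "'k::field fps \<Rightarrow> 'k fls fps" where
  "lift f = Abs_fps (\<lambda>n. fls_const (f $ n))"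

lemma lift_nth [simp]: "lift f $ n = fls_const (f $ n)"
  by (simp add: lift_def)

lemma fls_const_sum: "fls_const (sum f A) = (\<Sum>x\<in>A. fls_const (f x))"
  by (induction A rule: infinite_finite_induct) (simp_all flip: fls_plus_const)

lemma lift_add: "lift (f + g) = lift f + lift g"
  by (rule fps_ext) (simp add: fls_plus_const)

lemma lift_diff: "lift (f - g) = lift f - lift g"
  by (rule fps_ext) (simp add: fls_minus_const)

lemma lift_mult: "lift (f * g) = lift f * lift g"
  by (rule fps_ext) (simp add: fps_mult_nth fls_const_sum)

lemma lift_0 [simp]: "lift 0 = 0"
  by (rule fps_ext) simp

lemma lift_1 [simp]: "lift 1 = 1"
  by (rule fps_ext) simp

lemma lift_power: "lift (f ^ n) = lift f ^ n"
  by (induction n) (simp_all add: lift_mult)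

lemma lift_X [simp]: "lift fps_X = fps_X"
  by (rule fps_ext) (simp add: fps_X_def)

lemma lift_const [simp]: "lift (fps_const c) = fps_const (fls_const c)"
  by (rule fps_ext) simp

lemma zcoeff_lift: "zcoeff k (lift f * g) = f * zcoeff k g"
proof (rule fps_ext)
  fix n
  have "(sum h A) $$ k = (\<Sum>x\<in>A. h x $$ k)" for h :: "nat \<Rightarrow> 'a fls" and A
    by (induction A rule: infinite_finite_induct) auto
  then show "zcoeff k (lift f * g) $ n = (f * zcoeff k g) $ n"
    by (simp add: fps_mult_nth)
qed

lemma zcoeff_zvar: "zcoeff k (zvar * f) = zcoeff (k - 1) f"
  by (rule fps_ext) (simp add: fls_X_times_conv_shift)

abbreviation zinv :: "'k::field fls fps" where "zinv \<equiv> fps_const fls_X_inv"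

lemma zinv_zvar: "zinv * zvar = 1"
  by (simp add: fls_X_inv_times_conv_shift(1))

lemma zvar_zinv: "zvar * zinv = 1"
  using zinv_zvar by (simp add: mult.commute)

lemma zcoeff_zinv: "zcoeff k (zinv * f) = zcoeff (k + 1) f"
  by (rule fps_ext) (simp add: fls_X_inv_times_conv_shift)

section \<open>Series without a pole at \<open>z = 0\<close>\<close>

definition fls_regular :: "'k::field fls \<Rightarrow> bool" where
  "fls_regular f \<longleftrightarrow> (\<exists>g. f = fps_to_fls g)"

definition regular :: "'k::field fls fps \<Rightarrow> bool" where
  "regular f \<longleftrightarrow> (\<forall>n. fls_regular (f $ n))"

lemma fls_regular_add: "fls_regular f \<Longrightarrow> fls_regular g \<Longrightarrow> fls_regular (f + g)"
  unfolding fls_regular_def by (metis fps_to_fls_plus)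

lemma fls_regular_mult: "fls_regular f \<Longrightarrow> fls_regular g \<Longrightarrow> fls_regular (f * g)"
  unfolding fls_regular_def by (metis fls_times_fps_to_fls)

lemma fls_regular_uminus: "fls_regular f \<Longrightarrow> fls_regular (- f)"
  unfolding fls_regular_def by (metis fps_to_fls_uminus)

lemma fls_regular_0: "fls_regular 0"
  unfolding fls_regular_def by (intro exI[of _ 0]) simp

lemma fls_regular_const: "fls_regular (fls_const c)"
  unfolding fls_regular_def by (intro exI[of _ "fps_const c"]) simp

lemma fls_regular_X: "fls_regular fls_X"
  unfolding fls_regular_def by (intro exI[of _ fps_X]) simp

lemma fls_regular_sum: "(\<And>x. x \<in> A \<Longrightarrow> fls_regular (f x)) \<Longrightarrow> fls_regular (sum f A)"
  by (induction A rule: infinite_finite_induct) (auto simp: fls_regular_0 intro: fls_regular_add)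

lemma fls_regular_inverse:
  assumes "fls_regular f" "f $$ 0 \<noteq> 0"
  shows "fls_regular (inverse f)"
proof -
  obtain g where "f = fps_to_fls g"
    using assms(1) by (auto simp: fls_regular_def)
  moreover from this have "g $ 0 \<noteq> 0"
    using assms(2) by simp
  ultimately have "f * fps_to_fls (inverse g) = 1"
    by (simp add: fls_times_fps_to_fls[symmetric] inverse_mult_eq_1')
  then have "inverse f = fps_to_fls (inverse g)"
    by (rule inverse_unique)
  then show ?thesis
    by (auto simp: fls_regular_def)
qed

lemma regular_add [intro]: "regular f \<Longrightarrow> regular g \<Longrightarrow> regular (f + g)"
  by (auto simp: regular_def intro: fls_regular_add)

lemma regular_uminus [intro]: "regular f \<Longrightarrow> regular (- f)"
  by (auto simp: regular_def intro: fls_regular_uminus)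

lemma regular_diff [intro]: "regular f \<Longrightarrow> regular g \<Longrightarrow> regular (f - g)"
  using regular_add[of f "- g"] by auto

lemma regular_mult [intro]: "regular f \<Longrightarrow> regular g \<Longrightarrow> regular (f * g)"
  by (auto simp: regular_def fps_mult_nth intro!: fls_regular_sum fls_regular_mult)

lemma regular_lift [intro]: "regular (lift f)"
  by (simp add: regular_def fls_regular_const)

lemma regular_const [intro]: "regular (fps_const (fls_const c))"
  using regular_lift[of "fps_const c"] by simp

lemma regular_1 [intro]: "regular 1"
  using regular_lift[of 1] by simp

lemma regular_X [intro]: "regular fps_X"
  using regular_lift[of fps_X] by simp

lemma regular_zvar [intro]: "regular zvar"
  by (auto simp: regular_def fls_regular_X fls_regular_0)

lemma regular_power [intro]: "regular f \<Longrightarrow> regular (f ^ n)"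
  by (induction n) auto

text \<open>The recursion for the coefficients of the inverse divides only by \<open>f $ 0\<close>,
  a power series in \<open>z\<close> with nonzero constant term.\<close>

lemma regular_inverse:
  assumes f: "regular f" and nz: "f $ 0 $$ 0 \<noteq> 0"
  shows "regular (inverse f)"
proof -
  have f0: "f $ 0 \<noteq> 0"
    using nz by auto
  have "fls_regular (inverse f $ n)" for n
  proof (induction n rule: less_induct)
    case (less n)
    have inv: "fls_regular (inverse (f $ 0))"
      using f nz by (intro fls_regular_inverse) (auto simp: regular_def)
    show ?case
    proof (cases n)
      case 0
      with inv show ?thesis
        by simp
    next
      case (Suc m)
      have "(f * inverse f) $ n = 0"
        using inverse_mult_eq_1'[OF f0] Suc by simp
      then have "f $ 0 * inverse f $ n = - (\<Sum>i=1..n. f $ i * inverse f $ (n - i))"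
        by (simp add: fps_mult_nth sum.atLeast_Suc_atMost eq_neg_iff_add_eq_0)
      then have "inverse (f $ 0) * (f $ 0 * inverse f $ n)
          = inverse (f $ 0) * - (\<Sum>i=1..n. f $ i * inverse f $ (n - i))"
        by simp
      then have "inverse f $ n = inverse (f $ 0) * - (\<Sum>i=1..n. f $ i * inverse f $ (n - i))"
        using f0 by (simp add: mult.assoc[symmetric])
      moreover have "fls_regular \<dots>"
        using f less inv
        by (intro fls_regular_mult fls_regular_uminus fls_regular_sum) (auto simp: regular_def)
      ultimately show ?thesis
        by simp
    qed
  qed
  then show ?thesis
    by (simp add: regular_def)
qed

lemma zcoeff_regular: "regular f \<Longrightarrow> k < 0 \<Longrightarrow> zcoeff k f = 0"
proof (rule fps_ext)
  fix n assume *: "regular f" "k < 0"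
  then obtain g where "f $ n = fps_to_fls g"
    unfolding regular_def fls_regular_def by blast
  with * show "zcoeff k f $ n = 0 $ n"
    by simp
qed

text \<open>Contraction principle for the \<open>t\<close>-adic topology: under iteration from 0,
  coefficient \<open>n\<close> is stable after \<open>n + 1\<close> steps. The set \<open>A\<close>
  carries a property of the coefficients along, in particular the absence of poles in
  \<open>z\<close>.\<close>

lemma fps_fixpoint_exists:
  fixes \<Phi> :: "'a::zero fps \<Rightarrow> 'a fps"
  assumes contr: "\<And>f g n. (\<And>k. k < n \<Longrightarrow> f $ k = g $ k) \<Longrightarrow> \<Phi> f $ n = \<Phi> g $ n"
    and inv: "\<And>f. (\<And>n. f $ n \<in> A) \<Longrightarrow> (\<And>n. \<Phi> f $ n \<in> A)" "0 \<in> A"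
  shows "\<exists>f. \<Phi> f = f \<and> (\<forall>n. f $ n \<in> A)"
proof -
  define it where "it m = (\<Phi> ^^ m) 0" for m
  have it_Suc: "it (Suc m) = \<Phi> (it m)" for m
    by (simp add: it_def)
  have step: "it m $ n = it (Suc m) $ n" if "n < m" for m n
    using that
  proof (induction n arbitrary: m rule: less_induct)
    case (less n)
    obtain m' where m: "m = Suc m'"
      using less.prems by (cases m) auto
    have "it m' $ k = it (Suc m') $ k" if "k < n" for k
      using that less.prems m by (intro less.IH) auto
    then show ?case
      unfolding m it_Suc[of m'] it_Suc[of "Suc m'"] by (intro contr) (auto simp: it_Suc)
  qed
  have stable: "it m $ n = it (Suc n) $ n" if "n < m" for m n
    using that
  proof (induction m)
    case (Suc m)
    then show ?case
      using step[of n m] by (cases "n = m") auto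
  qed simp
  define f where "f = Abs_fps (\<lambda>n. it (Suc n) $ n)"
  have "\<Phi> f $ n = f $ n" for n
  proof -
    have "\<Phi> f $ n = \<Phi> (it n) $ n"
      by (rule contr) (simp only: f_def fps_nth_Abs_fps, rule stable[symmetric])
    then show ?thesis
      by (simp add: f_def it_Suc)
  qed
  moreover have "it m $ n \<in> A" for m n
    by (induction m arbitrary: n) (simp_all add: it_Suc inv it_def[of 0])
  ultimately show ?thesis
    by (intro exI[of _ f]) (auto intro!: fps_ext simp: f_def)
qed

lemma quadratic_fixpoint_exists:
  fixes p q r :: "'a::comm_ring_1 fps"
  assumes "\<And>n. p $ n \<in> A" "\<And>n. q $ n \<in> A" "\<And>n. r $ n \<in> A" and A0: "0 \<in> A"
    and A_add: "\<And>x y. x \<in> A \<Longrightarrow> y \<in> A \<Longrightarrow> x + y \<in> A"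
    and A_mult: "\<And>x y. x \<in> A \<Longrightarrow> y \<in> A \<Longrightarrow> x * y \<in> A"
  shows "\<exists>y. y = fps_X * (p + q * y + r * y ^ 2) \<and> (\<forall>n. y $ n \<in> A)"
proof -
  define \<Phi> where "\<Phi> y = fps_X * (p + q * y + r * y ^ 2)" for y
  have A_sum: "sum h I \<in> A" if "\<And>i. i \<in> I \<Longrightarrow> h i \<in> A" for h :: "nat \<Rightarrow> 'a" and I
    using that by (induction I rule: infinite_finite_induct) (auto simp: A0 A_add)
  have A_times: "(f * g) $ n \<in> A" if "\<And>n. f $ n \<in> A" "\<And>n. g $ n \<in> A" for f g n
    using that by (auto simp: fps_mult_nth intro!: A_sum A_mult)
  have "\<exists>f. \<Phi> f = f \<and> (\<forall>n. f $ n \<in> A)"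
  proof (rule fps_fixpoint_exists)
    fix f g :: "'a fps" and n
    assume eq: "\<And>k. k < n \<Longrightarrow> f $ k = g $ k"
    have "(h * f) $ m = (h' * g) $ m" if "m < n" "\<And>k. k < n \<Longrightarrow> h $ k = h' $ k" for h h' m
      unfolding fps_mult_nth using that eq by (intro sum.cong) auto
    then have "(p + q * f + r * (f * f)) $ m = (p + q * g + r * (g * g)) $ m" if "m < n" for m
      using that by (auto simp: mult.assoc[symmetric])
    then show "\<Phi> f $ n = \<Phi> g $ n"
      by (cases n) (auto simp: \<Phi>_def power2_eq_square)
  next
    fix f n assume "\<And>n. f $ n \<in> A"
    then have "(p + q * f + r * (f * f)) $ m \<in> A" for m
      using assms by (auto intro!: A_add A_times)
    then show "\<Phi> f $ n \<in> A"
      by (cases n) (auto simp: \<Phi>_def power2_eq_square A0)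
  qed (rule A0)
  then show ?thesis
    by (auto simp: \<Phi>_def eq_commute)
qed

text \<open>Extension by zero, so that the recurrence on the boundary can refer to neighbours
  outside the quadrant.\<close>

definition quadrant_ext :: "(nat \<Rightarrow> nat \<Rightarrow> 'k::zero) \<Rightarrow> int \<times> int \<Rightarrow> 'k" where
  "quadrant_ext r p = (if p \<in> quadrant then r (nat (fst p)) (nat (snd p)) else 0)"

section \<open>Models 2, 3 and 4\<close>

text \<open>These rules would merge \<open>zinv\<close>, \<open>zvar\<close> and the constants into
  single coefficients and so destroy the polynomial expressions in them.\<close>

declare fps_const_add [simp del] fps_const_sub [simp del] fps_const_mult [simp del]
  fps_const_neg [simp del] fps_const_power [simp del]

abbreviation cst :: "'k::field \<Rightarrow> 'k fls fps" where "cst c \<equiv> fps_const (fls_const c)"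

lemma zcoeff_cst: "zcoeff k (cst c * f) = fps_const c * zcoeff k f"
  using zcoeff_lift[of k "fps_const c" f] by simp

lemma quadrant_ext_simps:
  "quadrant_ext r (int i, int j) = r i j"
  "quadrant_ext r (- 1, y) = 0" "quadrant_ext r (x, - 1) = 0"
  by (auto simp: quadrant_ext_def quadrant_def)

lemma quadrant_cases:
  assumes "p \<in> quadrant"
  obtains i j where "p = (int i, int j)"
  using assms that[of "nat (fst p)" "nat (snd p)"] by (cases p) (auto simp: quadrant_def)

text \<open>
  The step polynomial is \<open>(1/x + e1 + x) (1/y + e2 + y) - th\<close>. The auxiliary variable is
  \<open>z = 1/x\<close>, so that rational functions of \<open>x\<close> are expanded at infinity, and \<open>Y\<close> is the root
  of the kernel that is a power series in \<open>t\<close>.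
\<close>

locale product_model =
  fixes S :: "(int \<times> int) set" and a b e1 e2 th :: "'k::field_char_0" and Y :: "'k fls fps"
  assumes fin: "finite S" and a: "a \<noteq> 0" and b: "b \<noteq> 0"
    and steps: "\<And>g :: int \<times> int \<Rightarrow> 'k fps. (\<Sum>s\<in>S. g s) =
      g (1, 1) + g (1, - 1) + g (- 1, 1) + g (- 1, - 1) + fps_const e2 * (g (1, 0) + g (- 1, 0))
      + fps_const e1 * (g (0, 1) + g (0, - 1)) + fps_const (e1 * e2 - th) * g (0, 0)"
    and Y: "Y = fps_X * ((zinv + cst e1 + zvar) + ((zinv + cst e1 + zvar) * cst e2 - cst th) * Y
              + (zinv + cst e1 + zvar) * Y ^ 2)"
begin

definition al :: 'k where "al = 1 - 1 / a"
definition be :: 'k where "be = 1 - 1 / b"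
text \<open>The correction \<open>th\<close> is moved to the diagonal: the kernel is
  \<open>T - t A (1/y + e2 + y)\<close>.\<close>

definition T0 :: "'k fps" where "T0 = 1 + fps_const th * fps_X"
definition T :: "'k fls fps" where "T = 1 + cst th * fps_X"
definition A :: "'k fls fps" where "A = zinv + cst e1 + zvar"
text \<open>By the kernel equation this is \<open>t A / Y\<close>, written without the division
  because \<open>Y\<close> has no constant term in \<open>t\<close>.\<close>

definition Z :: "'k fls fps" where "Z = T - cst e2 * fps_X * A - fps_X * A * Y"
definition lam :: "'k fls fps" where "lam = cst al - Z"
definition L :: "'k fls fps" where "L = inverse lam"
text \<open>With \<open>x = 1/z\<close>, \<open>P'\<close> arises from \<open>P = be A - T x\<close>
  by exchanging \<open>x\<close> and \<open>1/x\<close>, and \<open>xi\<close> is the antisymmetric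
  combination familiar from the reflection principle. The form of \<open>P\<close> is dictated by
  the boundary condition \<open>xm_eq\<close>.\<close>

definition P :: "'k fls fps" where "P = cst be * A - T * zinv"
definition P' :: "'k fls fps" where "P' = cst be * A - T * zvar"
text \<open>\<open>U = z P\<close> has the value \<open>be - 1 = -1/b\<close> at
  \<open>t = z = 0\<close>, unlike \<open>P\<close> it has no pole at \<open>z = 0\<close>; thus
  \<open>z V\<close> is the expansion of \<open>1 / P\<close>.\<close>

definition U :: "'k fls fps" where "U = cst be * zvar ^ 2 + cst (be * e1) * zvar + cst be - T"
definition V :: "'k fls fps" where "V = inverse U"
definition xi :: "nat \<Rightarrow> 'k fls fps" where "xi i = zinv ^ i * P - zvar ^ i * P'"
text \<open>Constant term of \<open>(xi i / P) Y^j / (al - Z)\<close>. The last factor is chosen so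
  that on \<open>y = 0\<close> the boundary defect reduces to \<open>xi i / P\<close>, whose
  constant term is known.\<close>

definition r :: "nat \<Rightarrow> nat \<Rightarrow> 'k fps" where
  "r i j = zcoeff 0 (xi i * Y ^ j * L * zvar * V)"

lemma T_lift: "T = lift T0"
  by (simp add: T_def T0_def lift_add lift_mult)

lemma Y_eq: "T * Y = fps_X * A * (1 + cst e2 * Y + Y ^ 2)"
proof -
  have "Y = fps_X * (A + (A * cst e2 - cst th) * Y + A * Y ^ 2)"
    using Y by (simp only: A_def)
  then have "fps_X * (A + (A * cst e2 - cst th) * Y + A * Y ^ 2) = Y"
    by simp
  moreover have "T * Y - fps_X * A * (1 + cst e2 * Y + Y ^ 2)
      = Y - fps_X * (A + (A * cst e2 - cst th) * Y + A * Y ^ 2)"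
    by (simp only: T_def) (simp add: algebra_simps)
  ultimately show ?thesis
    by simp
qed

lemma ZY: "Z * Y = fps_X * A"
proof -
  have "Z * Y = T * Y - fps_X * A * (cst e2 * Y + Y ^ 2)"
    by (simp only: Z_def power2_eq_square ring_distribs) (simp add: algebra_simps)
  then show ?thesis
    unfolding Y_eq by (simp only: ring_distribs) simp
qed

text \<open>\<open>Z\<close> and \<open>t A Y\<close> are the two roots, with sum
  \<open>T - e2 t A\<close> and product \<open>t^2 A^2\<close>.\<close>

lemma Z_quadratic: "Z ^ 2 - (T - cst e2 * fps_X * A) * Z + fps_X ^ 2 * A ^ 2 = 0"
proof -
  have "Z ^ 2 - (T - cst e2 * fps_X * A) * Z = - (fps_X * A) * (Z * Y)"
    by (simp only: Z_def power2_eq_square ring_distribs) (simp add: algebra_simps)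
  then show ?thesis
    unfolding ZY by (simp only: power2_eq_square) (simp add: algebra_simps)
qed

lemma zA: "zvar * A = 1 + cst e1 * zvar + zvar ^ 2"
  using zvar_zinv by (simp add: A_def ring_distribs power2_eq_square mult.commute[of zvar "cst e1"])

lemma lam_0: "lam $ 0 \<noteq> 0"
proof -
  have "lam $ 0 = fls_const (- 1 / a)"
    by (simp add: lam_def Z_def T_def al_def mult.assoc fls_minus_const[symmetric] fls_const_divide_const)
  then show ?thesis
    using a by (simp add: fls_const_eq_0_iff del: fls_const_uminus)
qed

lemma lam_L: "lam * L = 1"
  unfolding L_def using inverse_mult_eq_1'[OF lam_0] .

lemma U_00: "U $ 0 $$ 0 \<noteq> 0"
  using b by (simp add: U_def T_def be_def power2_eq_square)

lemma UV: "U * V = 1"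
  unfolding V_def by (rule inverse_mult_eq_1') (use U_00 in auto)

lemma regular_U: "regular U"
  unfolding U_def T_lift by (intro regular_add regular_diff regular_mult regular_const regular_zvar regular_power regular_lift)

lemma regular_V: "regular V"
  unfolding V_def by (rule regular_inverse[OF regular_U U_00])

lemma zP: "zvar * P = U"
proof -
  have "zvar * P = cst be * (zvar * A) - T * (zvar * zinv)"
    by (simp only: P_def) (simp add: algebra_simps)
  also have "\<dots> = U"
    unfolding zA zvar_zinv U_def by (simp add: algebra_simps flip: fps_const_mult fls_const_mult_const)
  finally show ?thesis .
qed

lemma zP': "zvar * P' = cst be * (1 + cst e1 * zvar + zvar ^ 2) - T * zvar ^ 2"
proof -
  have "zvar * P' = cst be * (zvar * A) - T * zvar ^ 2"
    by (simp only: P'_def power2_eq_square) (simp add: algebra_simps)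
  then show ?thesis
    by (simp only: zA)
qed

lemma xi_neighbours: "xi i + cst e1 * xi (Suc i) + xi (Suc (Suc i)) = A * xi (Suc i)"
proof -
  have "xi i + cst e1 * xi (Suc i) + xi (Suc (Suc i)) - A * xi (Suc i)
      = (1 - zinv * zvar) * (zinv ^ i * P) - (1 - zvar * zinv) * (zvar ^ i * P')"
    unfolding xi_def A_def by (simp only: power_Suc) (simp add: algebra_simps)
  then show ?thesis
    unfolding zvar_zinv zinv_zvar by simp
qed

text \<open>The formula for \<open>xi\<close>, continued to index -1.\<close>

definition xm :: "'k fls fps" where "xm = zvar * P - zinv * P'"

lemma xi_boundary: "cst e1 * xi 0 + xi 1 = A * xi 0 - xm"
  unfolding xi_def xm_def A_def by (simp add: algebra_simps)

text \<open>Since \<open>T z - be A = - P'\<close> and \<open>T / z - be A = - P\<close>, the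
  difference of the two sides is \<open>- P P' + P' P\<close>. Together with
  \<open>xi_boundary\<close> this produces the factor \<open>1 - be / T\<close> on
  \<open>x = 0\<close>.\<close>

lemma xm_eq: "T * xm = cst be * A * xi 0"
proof -
  have "T * xm - cst be * A * xi 0 = T * T * (zinv * zvar - zvar * zinv)"
    unfolding xm_def xi_def P_def P'_def
    by (simp add: algebra_simps)
  then show ?thesis
    by (simp add: mult.commute)
qed

lemma A_nz: "A \<noteq> 0"
proof
  assume "A = 0"
  then have "(zvar * A) $ 0 $$ 0 = 0"
    by simp
  then show False
    unfolding zA by (simp add: power2_eq_square)
qed

lemma xi_L: "lam * (xi i * Y ^ 0 * L * zvar * V) = xi i * zvar * V"
proof -
  have "lam * (xi i * Y ^ 0 * L * zvar * V) = (lam * L) * (xi i * zvar * V)"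
    by (simp add: mult_ac)
  then show ?thesis
    by (simp add: lam_L)
qed

text \<open>The expansion of \<open>xi i / P\<close> at \<open>z = 0\<close>: the pure power
  \<open>z^(-i)\<close> minus \<open>z^i\<close> times the regular series \<open>P' / P\<close>. For
  \<open>i > 0\<close> neither part has a constant term.\<close>

lemma xi_zV: "xi i * zvar * V = zinv ^ i - zvar ^ i * ((zvar * P') * V)"
proof -
  have "xi i * zvar * V = zinv ^ i * ((zvar * P) * V) - zvar ^ i * ((zvar * P') * V)"
    unfolding xi_def by (simp add: algebra_simps)
  then show ?thesis
    by (simp add: zP UV)
qed

lemma regular_zP': "regular (zvar * P')"
  unfolding zP' T_lift by (intro regular_add regular_diff regular_mult regular_const regular_zvar regular_power regular_lift regular_1)

lemma zcoeff_xi_Suc: "zcoeff 0 (xi (Suc i) * zvar * V) = 0"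
proof -
  have "zcoeff 0 (zinv ^ Suc i) = (0 :: 'k fps)"
    by (rule fps_ext) (simp add: fps_const_power del: power_Suc)
  moreover have "zcoeff 0 (zvar ^ Suc i * ((zvar * P') * V)) = 0"
    unfolding power_Suc mult.assoc[of zvar "zvar ^ i"] zcoeff_zvar
    by (intro zcoeff_regular regular_mult regular_power regular_zvar regular_zP' regular_V) simp
  ultimately show ?thesis
    unfolding xi_zV by simp
qed

lemma zcoeff_xi_0: "(T0 - fps_const be) * zcoeff 0 (xi 0 * zvar * V) = T0"
proof -
  \<comment> \<open>\<open>c\<close> is the value of \<open>V\<close> at \<open>z = 0\<close>;
    reading \<open>U V = 1\<close> there gives \<open>(be - T0) c = 1\<close>.\<close>
  define c where "c = zcoeff 0 V"
  have reg: "zcoeff 0 (zvar * f) = 0" if "regular f" for f :: "'k fls fps"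
    unfolding zcoeff_zvar using that by (intro zcoeff_regular) auto
  have "zcoeff 0 (zvar ^ 0 * ((zvar * P') * V))
      = zcoeff 0 (lift (fps_const be) * V + zvar * ((cst be * (cst e1 + zvar) - T * zvar) * V))"
    unfolding zP' by (intro arg_cong[of _ _ "zcoeff 0"]) (simp add: algebra_simps power2_eq_square)
  also have "\<dots> = fps_const be * c"
    unfolding zcoeff_add zcoeff_lift c_def T_lift
    by (subst reg) (auto intro!: regular_add regular_diff regular_mult regular_const regular_zvar regular_lift regular_V)
  finally have 1: "zcoeff 0 (xi 0 * zvar * V) = zcoeff 0 1 - fps_const be * c"
    unfolding xi_zV by simp
  have "zcoeff 0 1 = zcoeff 0 (U * V)"
    by (simp only: UV)
  also have "\<dots> = zcoeff 0 (lift (fps_const be - T0) * V + zvar * ((cst be * zvar + cst (be * e1)) * V))"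
    unfolding U_def T_lift lift_diff
    by (intro arg_cong[of _ _ "zcoeff 0"]) (simp add: algebra_simps power2_eq_square)
  also have "\<dots> = (fps_const be - T0) * c"
    unfolding zcoeff_add zcoeff_lift c_def
    by (subst reg) (auto intro!: regular_add regular_diff regular_mult regular_const regular_zvar regular_lift regular_V)
  finally have 2: "zcoeff 0 1 = (fps_const be - T0) * c" .
  have 3: "zcoeff 0 1 = (1 :: 'k fps)"
    by (rule fps_ext) simp
  have "(T0 - fps_const be) * (1 - fps_const be * c) = T0 - fps_const be + fps_const be * ((fps_const be - T0) * c)"
    by (simp add: algebra_simps)
  then show ?thesis
    unfolding 1 3 using 2 3 by (simp)
qed

text \<open>
  The family \<open>r\<close> satisfies the recurrence of the weighted walks away from the origin: in the interior
  because \<open>Y\<close> is a root of the kernel, on \<open>x = 0\<close> by the choice of \<open>xi\<close>, and on \<open>y = 0\<close> because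
  \<open>xi (Suc i) / P\<close> has no constant term in its expansion at infinity.
\<close>

definition Nx :: "nat \<Rightarrow> nat \<Rightarrow> 'k fps" where
  "Nx i j = fps_const e1 * r i j + r (Suc i) j + (case i of 0 \<Rightarrow> 0 | Suc k \<Rightarrow> r k j)"

definition N :: "nat \<Rightarrow> nat \<Rightarrow> 'k fps" where
  "N i j = fps_const e2 * Nx i j + Nx i (Suc j) + (case j of 0 \<Rightarrow> 0 | Suc k \<Rightarrow> Nx i k)"

definition G :: "nat \<Rightarrow> 'k fls fps" where
  "G i = A * xi i - (if i = 0 then xm else 0)"

lemma Nx_eq: "Nx i j = zcoeff 0 (G i * Y ^ j * L * zvar * V)"
proof -
  have "cst e1 * xi i + xi (Suc i) + (case i of 0 \<Rightarrow> 0 | Suc k \<Rightarrow> xi k) = G i"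
    using xi_boundary xi_neighbours by (auto simp: G_def algebra_simps split: nat.split)
  then have "zcoeff 0 (G i * Y ^ j * L * zvar * V)
      = zcoeff 0 ((cst e1 * xi i + xi (Suc i) + (case i of 0 \<Rightarrow> 0 | Suc k \<Rightarrow> xi k)) * Y ^ j * L * zvar * V)"
    by simp
  also have "\<dots> = Nx i j"
    unfolding Nx_def r_def ring_distribs
    by (auto simp: mult.assoc zcoeff_cst split: nat.split)
  finally show ?thesis ..
qed

lemma G_step: "fps_X * G i * (1 + cst e2 * Y + Y ^ 2) = (T - (if i = 0 then cst be else 0)) * xi i * Y"
proof (cases i)
  case 0
  \<comment> \<open>The extra factor \<open>A\<close> makes the kernel equation \<open>Y_eq\<close>
    applicable; it is cancelled at the end.\<close>
  have "A * (fps_X * G 0 * (1 + cst e2 * Y + Y ^ 2)) = G 0 * (T * Y)"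
    unfolding Y_eq by (simp add: mult_ac)
  also have "\<dots> = (T * A * xi 0 - T * xm) * Y"
    by (simp add: G_def algebra_simps)
  also have "\<dots> = A * ((T - cst be) * xi 0 * Y)"
    unfolding xm_eq by (simp add: algebra_simps)
  finally show ?thesis
    using 0 A_nz by simp
next
  case (Suc k)
  have "fps_X * G i * (1 + cst e2 * Y + Y ^ 2) = (T * Y) * xi i"
    unfolding Y_eq using Suc by (simp add: G_def mult_ac)
  then show ?thesis
    using Suc by (simp add: mult_ac)
qed

lemma N_Suc: "fps_X * N i (Suc j) = (T0 - (if i = 0 then fps_const be else 0)) * r i (Suc j)"
proof -
  have "fps_X * N i (Suc j) = zcoeff 0 ((fps_X * G i * (1 + cst e2 * Y + Y ^ 2)) * Y ^ j * L * zvar * V)"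
    unfolding N_def Nx_eq
    by (simp add: zcoeff_X[symmetric] zcoeff_cst[symmetric] zcoeff_add[symmetric] power2_eq_square
          del: zcoeff_add)
       (simp add: algebra_simps)
  also have "\<dots> = zcoeff 0 (lift (T0 - (if i = 0 then fps_const be else 0)) * (xi i * Y ^ Suc j * L * zvar * V))"
    unfolding G_step by (simp add: lift_diff T_lift mult_ac)
  finally show ?thesis
    unfolding zcoeff_lift r_def .
qed

lemma tAY: "fps_X * A * (cst e2 + Y) = T - Z"
  by (simp add: Z_def algebra_simps)

lemma N_0: "fps_X * N i 0 = zcoeff 0 (fps_X * G i * (cst e2 + Y) * L * zvar * V)"
  unfolding N_def Nx_eq
  by (simp add: zcoeff_X[symmetric] zcoeff_cst[symmetric] zcoeff_add[symmetric] del: zcoeff_add)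
     (simp add: algebra_simps)

text \<open>Here \<open>t A (e2 + Y) = T - Z = (T - al) + lam\<close>. As \<open>lam L = 1\<close>,
  the second summand leaves the constant term of \<open>xi (Suc i) / P\<close>, which is 0.\<close>

lemma N_Suc_0: "fps_X * N (Suc i) 0 = (T0 - fps_const al) * r (Suc i) 0"
proof -
  have "fps_X * G (Suc i) * (cst e2 + Y) = (T - Z) * xi (Suc i)"
    unfolding tAY[symmetric] by (simp add: G_def mult_ac)
  also have "\<dots> = (T - cst al) * xi (Suc i) + lam * xi (Suc i)"
    by (simp add: lam_def algebra_simps)
  finally have eq: "fps_X * G (Suc i) * (cst e2 + Y) = (T - cst al) * xi (Suc i) + lam * xi (Suc i)" .
  have "fps_X * G (Suc i) * (cst e2 + Y) * L * zvar * V
      = (T - cst al) * (xi (Suc i) * Y ^ 0 * L * zvar * V) + lam * (xi (Suc i) * Y ^ 0 * L * zvar * V)"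
    unfolding eq by (simp add: algebra_simps)
  also have "\<dots> = lift (T0 - fps_const al) * (xi (Suc i) * Y ^ 0 * L * zvar * V) + xi (Suc i) * zvar * V"
    unfolding xi_L by (simp add: T_lift lift_diff)
  finally show ?thesis
    unfolding N_0 by (simp add: zcoeff_lift zcoeff_xi_Suc r_def)
qed

text \<open>At the origin the factors \<open>T - Z = (T - al) + lam\<close> and
  \<open>(T - be) / T\<close> meet, hence the diagonal entry \<open>(T0 - al)(T0 - be) / T0\<close>.
  The \<open>lam\<close> part has constant term \<open>T0 / (T0 - be)\<close> by
  \<open>zcoeff_xi_0\<close>, so the source is 1.\<close>

lemma N_0_0: "T0 * (fps_X * N 0 0) = (T0 - fps_const al) * (T0 - fps_const be) * r 0 0 + T0"
proof -
  have "A * (T * (fps_X * G 0 * (cst e2 + Y))) = T * G 0 * (fps_X * A * (cst e2 + Y))"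
    by (simp add: mult_ac)
  also have "\<dots> = (T * A * xi 0 - T * xm) * (T - Z)"
    unfolding tAY by (simp add: G_def algebra_simps)
  also have "\<dots> = A * ((T - Z) * (T - cst be) * xi 0)"
    unfolding xm_eq by (simp add: algebra_simps)
  finally have "T * (fps_X * G 0 * (cst e2 + Y)) = (T - Z) * (T - cst be) * xi 0"
    using A_nz by simp
  also have "\<dots> = (T - cst al) * (T - cst be) * xi 0 + (T - cst be) * (lam * xi 0)"
    by (simp add: lam_def algebra_simps)
  finally have eq: "T * (fps_X * G 0 * (cst e2 + Y))
      = (T - cst al) * (T - cst be) * xi 0 + (T - cst be) * (lam * xi 0)" .
  have "T * (fps_X * G 0 * (cst e2 + Y) * L * zvar * V) = T * (fps_X * G 0 * (cst e2 + Y)) * (L * zvar * V)"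
    by (simp add: mult_ac)
  also have "\<dots>
      = (T - cst al) * (T - cst be) * (xi 0 * Y ^ 0 * L * zvar * V) + (T - cst be) * (lam * (xi 0 * Y ^ 0 * L * zvar * V))"
    unfolding eq by (simp add: algebra_simps)
  also have "\<dots> = lift ((T0 - fps_const al) * (T0 - fps_const be)) * (xi 0 * Y ^ 0 * L * zvar * V)
      + lift (T0 - fps_const be) * (xi 0 * zvar * V)"
    unfolding xi_L by (simp add: T_lift lift_diff lift_mult)
  finally have "lift T0 * (fps_X * G 0 * (cst e2 + Y) * L * zvar * V)
      = lift ((T0 - fps_const al) * (T0 - fps_const be)) * (xi 0 * Y ^ 0 * L * zvar * V)
      + lift (T0 - fps_const be) * (xi 0 * zvar * V)"
    by (simp only: T_lift)
  then have "zcoeff 0 (lift T0 * (fps_X * G 0 * (cst e2 + Y) * L * zvar * V)) =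
     zcoeff 0 (lift ((T0 - fps_const al) * (T0 - fps_const be)) * (xi 0 * Y ^ 0 * L * zvar * V)
      + lift (T0 - fps_const be) * (xi 0 * zvar * V))"
    by simp
  then show ?thesis
    unfolding N_0 zcoeff_add zcoeff_lift zcoeff_xi_0 r_def .
qed

text \<open>The factor \<open>T0\<close> clears the denominator of the diagonal entry at the
  origin.\<close>

definition R :: "int \<times> int \<Rightarrow> 'k fps" where
  "R = quadrant_ext (\<lambda>i j. T0 * r i j)"

lemma R_sum: "(\<Sum>s\<in>S. R ((int i, int j) - s)) = T0 * (N i j - fps_const th * r i j)"
  unfolding steps R_def
  by (cases i; cases j)
     (simp_all add: quadrant_ext_def quadrant_def N_def Nx_def nat_add_distrib algebra_simps
        flip: fps_const_mult fps_const_sub)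

lemma vertex_weights:
  "fps_const a * (1 - fps_const al) = 1" "fps_const b * (1 - fps_const be) = 1"
  using a b by (simp_all add: al_def be_def ring_distribs fps_const_sub[symmetric] fps_const_mult)

lemma R_eq:
  "R (int i, int j) = (if i = 0 \<and> j = 0
      then fps_const (a * b) * (fps_const (al * be * th) * fps_X * r 0 0 - T0) else 0) +
    fps_const (vertex_weight a b (int i, int j)) * fps_X * (\<Sum>s\<in>S. R ((int i, int j) - s))"
proof -
  define D where "D = T0 * (fps_X * N i j - (T0 - 1) * r i j)"
  have T0: "fps_const th * fps_X = T0 - 1"
    by (simp add: T0_def)
  have sum: "fps_X * (\<Sum>s\<in>S. R ((int i, int j) - s)) = D"
    unfolding R_sum D_def by (simp add: algebra_simps T0[symmetric])
  have val: "R (int i, int j) = T0 * r i j"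
    by (simp add: R_def quadrant_ext_simps)
  have "T0 * r i j = (if i = 0 \<and> j = 0
      then fps_const (a * b) * (fps_const (al * be * th) * fps_X * r 0 0 - T0) else 0) +
    fps_const (vertex_weight a b (int i, int j)) * D"
  proof (cases "i = 0"; cases "j = 0")
    assume ij: "i = 0" "j \<noteq> 0"
    then obtain j' where "j = Suc j'"
      by (cases j) auto
    then have "fps_const b * D = (fps_const b * (1 - fps_const be)) * (T0 * r i j)"
      using ij by (simp add: D_def N_Suc algebra_simps)
    then show ?thesis
      using ij unfolding vertex_weights by (simp add: vertex_weight_def)
  next
    assume ij: "i \<noteq> 0" "j = 0"
    then obtain i' where "i = Suc i'"
      by (cases i) auto
    then have "fps_const a * D = (fps_const a * (1 - fps_const al)) * (T0 * r i j)"
      using ij by (simp add: D_def N_Suc_0 algebra_simps)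
    then show ?thesis
      using ij unfolding vertex_weights by (simp add: vertex_weight_def)
  next
    assume ij: "i \<noteq> 0" "j \<noteq> 0"
    then obtain j' where "j = Suc j'"
      by (cases j) auto
    then have "D = T0 * r i j"
      using ij by (simp add: D_def N_Suc algebra_simps)
    then show ?thesis
      using ij by (simp add: vertex_weight_def)
  next
    assume ij: "i = 0" "j = 0"
    \<comment> \<open>The entry \<open>(1 - al)(1 - be)\<close> demanded by the weights is split
      off; what remains is the rank one term and the source.\<close>
    have D_eq: "D = (1 - fps_const al) * (1 - fps_const be) * (T0 * r 0 0)
          - (fps_const al * fps_const be * (T0 - 1) * r 0 0 - T0)"
      using N_0_0 ij by (simp add: D_def algebra_simps)
    have "fps_const a * fps_const b * D
        = (fps_const a * (1 - fps_const al)) * (fps_const b * (1 - fps_const be)) * (T0 * r 0 0)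
          - fps_const a * fps_const b * (fps_const al * fps_const be * (T0 - 1) * r 0 0 - T0)"
      unfolding D_eq by (simp add: algebra_simps)
    then have "T0 * r 0 0 = fps_const (a * b) * (fps_const (al * be * th) * fps_X * r 0 0 - T0)
        + fps_const (a * b) * D"
      unfolding vertex_weights T0[symmetric] fps_const_mult[symmetric] by (simp add: mult_ac)
    then show ?thesis
      using ij by (simp add: vertex_weight_def)
  qed
  then show ?thesis
    unfolding val mult.assoc[of "fps_const (vertex_weight a b (int i, int j))" fps_X] sum .
qed

lemma walk_gf_eq:
  "T0 * r 0 0 = fps_const (a * b) * (fps_const (al * be * th) * fps_X * r 0 0 - T0) * walk_gf S a b"
proof -
  have "R (0, 0) = fps_const (a * b) * (fps_const (al * be * th) * fps_X * r 0 0 - T0) * walk_gf S a b"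
  proof (rule walk_gf_unique[OF fin])
    fix p :: "int \<times> int"
    show "R p = 0" if "p \<notin> quadrant"
      using that by (simp add: R_def quadrant_ext_def)
    assume "p \<in> quadrant"
    then obtain i j where p: "p = (int i, int j)"
      by (rule quadrant_cases)
    show "R p = (if p = (0, 0) then fps_const (a * b) * (fps_const (al * be * th) * fps_X * r 0 0 - T0) else 0) +
        fps_const (vertex_weight a b p) * fps_X * (\<Sum>s\<in>S. R (p - s))"
      unfolding p R_eq[of i j] by simp
  qed
  then show ?thesis
    by (simp add: R_def quadrant_ext_def quadrant_def)
qed

section \<open>The value at the origin is the residue of a sum of hyperexponentials\<close>

definition f :: "'k fls fps" where
  "f = zinv * (xi 0 * L * zvar * V)"

lemma r_residue: "r 0 0 = zcoeff (- 1) f"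
  unfolding f_def zcoeff_zinv r_def by simp

lemma bipoly_cst_T: "bipoly (cst c)" "bipoly T"
  unfolding T_def by (intro bipoly_const bipoly_add bipoly_mult bipoly_1 bipoly_X)+

lemma hyperexp_sum_zinv: "hyperexp_sum zinv"
  by (rule hyperexp_sum_cancel[of zvar]) (auto simp: zvar_zinv)

lemma hyperexp_sum_xi: "hyperexp_sum (xi 0)"
  unfolding xi_def P_def P'_def A_def
  by (intro hyperexp_sum_diff hyperexp_sum_mult hyperexp_sum_add hyperexp_sum_power hyperexp_sum_zinv
      hyperexp_sum_bipoly[OF bipoly_zvar] hyperexp_sum_bipoly[OF bipoly_cst_T(1)]
      hyperexp_sum_bipoly[OF bipoly_cst_T(2)])

lemma hyperexp_sum_V: "hyperexp_sum V"
proof (rule hyperexp_sum_cancel)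
  show "hyperexp_sum (U * V)"
    unfolding UV by (intro hyperexp_sum_bipoly bipoly_1)
  show "bipoly U"
    unfolding U_def by (intro bipoly_add bipoly_diff bipoly_mult bipoly_power bipoly_zvar bipoly_cst_T)
  show "U \<noteq> 0"
    using UV by auto
qed

text \<open>Multiplying the quadratic equation of \<open>Z\<close> by \<open>L^2\<close> and
  inserting \<open>Z L = al L - 1\<close> gives a quadratic equation for \<open>L\<close>; the
  factor \<open>z^2\<close> clears the poles of \<open>A\<close>.\<close>

lemma hyperexp_sum_L: "hyperexp_sum L"
proof -
  define B where "B = 1 + cst e1 * zvar + zvar ^ 2"
  define W where "W = zvar * T - cst e2 * fps_X * B"
  have B: "zvar * A = B"
    by (simp add: B_def zA)
  have "zvar ^ 2 * Z ^ 2 - zvar * W * Z + fps_X ^ 2 * B ^ 2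
      = zvar ^ 2 * (Z ^ 2 - (T - cst e2 * fps_X * A) * Z + fps_X ^ 2 * A ^ 2)"
    unfolding W_def B[symmetric] by (simp add: algebra_simps power2_eq_square)
  then have "zvar ^ 2 * Z ^ 2 - zvar * W * Z + fps_X ^ 2 * B ^ 2 = 0"
    unfolding Z_quadratic by simp
  then have "(zvar ^ 2 * Z ^ 2 - zvar * W * Z + fps_X ^ 2 * B ^ 2) * L ^ 2 = 0"
    by simp
  moreover have "(zvar ^ 2 * Z ^ 2 - zvar * W * Z + fps_X ^ 2 * B ^ 2) * L ^ 2
      = zvar ^ 2 * (Z * L) ^ 2 - zvar * W * (Z * L) * L + fps_X ^ 2 * B ^ 2 * L ^ 2"
    by (simp add: algebra_simps power2_eq_square)
  moreover have "Z * L = cst al * L - 1"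
    using lam_L by (simp add: lam_def algebra_simps)
  ultimately have "zvar ^ 2 * (cst al * L - 1) ^ 2 - zvar * W * (cst al * L - 1) * L + fps_X ^ 2 * B ^ 2 * L ^ 2 = 0"
    by simp
  then have eq: "(zvar ^ 2 * cst al ^ 2 - zvar * W * cst al + fps_X ^ 2 * B ^ 2) * L ^ 2
      + (zvar * W - 2 * cst al * zvar ^ 2) * L + zvar ^ 2 = 0"
    by (simp add: algebra_simps power2_eq_square)
  have bi: "bipoly W" "bipoly B"
    unfolding W_def B_def
    by (intro bipoly_add bipoly_diff bipoly_mult bipoly_power bipoly_zvar bipoly_X bipoly_1 bipoly_cst_T)+
  show ?thesis
  proof (rule hyperexp_sum_quadratic[OF _ _ _ eq])
    show "bipoly (zvar ^ 2 * cst al ^ 2 - zvar * W * cst al + fps_X ^ 2 * B ^ 2)"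
      "bipoly (zvar * W - 2 * cst al * zvar ^ 2)" "bipoly (zvar ^ 2 :: 'k fls fps)"
      by (intro bipoly_add bipoly_diff bipoly_mult bipoly_power bipoly_numeral bipoly_zvar bipoly_X bipoly_cst_T bi)+
    \<comment> \<open>If both leading coefficients vanished, the equation would read
      \<open>z^2 = 0\<close>.\<close>
    have "(zvar :: 'k fls fps) ^ 2 \<noteq> 0"
      by (simp add: fps_const_power)
    with eq show "zvar ^ 2 * cst al ^ 2 - zvar * W * cst al + fps_X ^ 2 * B ^ 2 \<noteq> 0 \<or>
        zvar * W - 2 * cst al * zvar ^ 2 \<noteq> 0"
      by auto
  qed
qed

lemma hyperexp_sum_f: "hyperexp_sum f"
  unfolding f_def
  by (intro hyperexp_sum_mult hyperexp_sum_power hyperexp_sum_zinv hyperexp_sum_xi hyperexp_sum_L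
      hyperexp_sum_V hyperexp_sum_bipoly[OF bipoly_zvar])

lemma D_finite_ratio_walk_gf: "D_finite_ratio (walk_gf S a b)"
proof -
  define F where "F = T0 * r 0 0"
  define H where "H = fps_const (a * b) * (fps_const (al * be * th) * fps_X * r 0 0 - T0)"
  have bi: "hyperexp_sum (cst c)" "hyperexp_sum T" "hyperexp_sum (fps_X :: 'k fls fps)" for c
    by (intro hyperexp_sum_bipoly bipoly_cst_T bipoly_X)+
  have "F = zcoeff (- 1) (T * f)"
    by (simp add: F_def T_lift zcoeff_lift r_residue)
  moreover have "hyperexp_sum (T * f)"
    by (intro hyperexp_sum_mult hyperexp_sum_f bi)
  ultimately have F: "D_finite F"
    by (simp add: D_finite_residue)
  \<comment> \<open>Since \<open>zinv\<close> has residue 1, the part of \<open>H\<close> free of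
    \<open>r 0 0\<close> is a residue too, and \<open>H\<close> is the residue of one
    expression.\<close>
  have "zcoeff (- 1) zinv = (1 :: 'k fps)"
    by (rule fps_ext) simp
  then have "H = zcoeff (- 1) (cst (a * b) * (cst (al * be * th) * (fps_X * f) - T * zinv))"
    by (simp add: H_def T_lift zcoeff_lift zcoeff_cst zcoeff_X r_residue mult.assoc)
  moreover have "hyperexp_sum (cst (a * b) * (cst (al * be * th) * (fps_X * f) - T * zinv))"
    by (intro hyperexp_sum_mult hyperexp_sum_diff hyperexp_sum_f hyperexp_sum_zinv bi)
  ultimately have H: "D_finite H"
    by (simp add: D_finite_residue)
  have "H $ 0 = - (a * b)"
    by (simp add: H_def T0_def mult.assoc)
  with a b have H_nz: "H \<noteq> 0"
    by auto
  have "F = H * walk_gf S a b"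
    unfolding F_def H_def by (rule walk_gf_eq)
  then have "fps_to_fls F = fps_to_fls H * fps_to_fls (walk_gf S a b)"
    by (simp add: fls_times_fps_to_fls)
  with H_nz have "fps_to_fls (walk_gf S a b) = fps_to_fls F / fps_to_fls H"
    by simp
  with F H H_nz show ?thesis
    unfolding D_finite_ratio_def by blast
qed

lemma D_finite_walk_gf:
  assumes "a = 1 \<or> b = 1 \<or> th = 0"
  shows "D_finite (walk_gf S a b)"
proof -
  have "al * be * th = 0"
    using assms by (auto simp: al_def be_def)
  with walk_gf_eq have "T0 * r 0 0 = fps_const (a * b) * (- T0) * walk_gf S a b"
    by simp
  then have "T0 * r 0 0 = T0 * (- fps_const (a * b) * walk_gf S a b)"
    by (simp add: mult_ac)
  moreover have "T0 \<noteq> 0"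
  proof
    assume "T0 = 0"
    then have "T0 $ 0 = 0" by simp
    then show False by (simp add: T0_def mult.assoc)
  qed
  ultimately have "r 0 0 = - fps_const (a * b) * walk_gf S a b"
    by (metis mult_left_cancel)
  then have "fps_const (- 1 / (a * b)) * r 0 0 = (fps_const (- 1 / (a * b)) * fps_const (- (a * b))) * walk_gf S a b"
    by (simp add: mult.assoc fps_const_neg[symmetric])
  also have "fps_const (- 1 / (a * b)) * fps_const (- (a * b)) = 1"
    using a b by (simp add: fps_const_mult)
  finally have "walk_gf S a b = zcoeff (- 1) (cst (- 1 / (a * b)) * f)"
    by (simp only: zcoeff_cst r_residue mult_1)
  moreover have "hyperexp_sum (cst (- 1 / (a * b)) * f)"
    by (intro hyperexp_sum_mult hyperexp_sum_f hyperexp_sum_bipoly bipoly_const)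
  ultimately show ?thesis
    by (simp add: D_finite_residue)
qed

end

section \<open>Models 2, 3 and 4 as instances of the product model\<close>

lemma product_model_exists:
  fixes a b e1 e2 th :: "'k::field_char_0"
  assumes "finite S" "a \<noteq> 0" "b \<noteq> 0"
    and "\<And>g :: int \<times> int \<Rightarrow> 'k fps. (\<Sum>s\<in>S. g s) =
      g (1, 1) + g (1, - 1) + g (- 1, 1) + g (- 1, - 1) + fps_const e2 * (g (1, 0) + g (- 1, 0))
      + fps_const e1 * (g (0, 1) + g (0, - 1)) + fps_const (e1 * e2 - th) * g (0, 0)"
  shows "\<exists>Y. product_model S a b e1 e2 th Y"
proof -
  let ?A = "zinv + cst e1 + zvar"
  obtain Y where "Y = fps_X * (?A + (?A * cst e2 - cst th) * Y + ?A * Y ^ 2)"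
    using quadratic_fixpoint_exists[of ?A UNIV "?A * cst e2 - cst th" ?A] by auto
  with assms show ?thesis
    by (intro exI[of _ Y]) (simp only: product_model_def simp_thms)
qed

text \<open>The step polynomials of Models 2, 3 and 4 are \<open>(1/x + x)(1/y + y)\<close>,
  \<open>(1/x + 1 + x)(1/y + y)\<close> and \<open>(1/x + 1 + x)(1/y + 1 + y) - 1\<close>.\<close>

lemma sum_model2:
  fixes g :: "int \<times> int \<Rightarrow> 'k::field fps"
  shows "(\<Sum>s\<in>model2. g s) =
      g (1, 1) + g (1, - 1) + g (- 1, 1) + g (- 1, - 1) + fps_const 0 * (g (1, 0) + g (- 1, 0))
      + fps_const 0 * (g (0, 1) + g (0, - 1)) + fps_const (0 * 0 - 0) * g (0, 0)"
  by (simp add: model2_def add.assoc)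

lemma sum_model3:
  fixes g :: "int \<times> int \<Rightarrow> 'k::field fps"
  shows "(\<Sum>s\<in>model3. g s) =
      g (1, 1) + g (1, - 1) + g (- 1, 1) + g (- 1, - 1) + fps_const 0 * (g (1, 0) + g (- 1, 0))
      + fps_const 1 * (g (0, 1) + g (0, - 1)) + fps_const (1 * 0 - 0) * g (0, 0)"
  by (simp add: model3_def add_ac)

lemma sum_model4:
  fixes g :: "int \<times> int \<Rightarrow> 'k::field fps"
  shows "(\<Sum>s\<in>model4. g s) =
      g (1, 1) + g (1, - 1) + g (- 1, 1) + g (- 1, - 1) + fps_const 1 * (g (1, 0) + g (- 1, 0))
      + fps_const 1 * (g (0, 1) + g (0, - 1)) + fps_const (1 * 1 - 1) * g (0, 0)"
proof -
  have "model4 = {(1, 1), (1, - 1), (- 1, 1), (- 1, - 1), (1, 0), (- 1, 0), (0, 1), (0, - 1)}"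
    by (auto simp: model4_def)
  show ?thesis
    unfolding \<open>model4 = _\<close> by (simp add: add_ac)
qed

lemma finite_models: "finite model1" "finite model2" "finite model3" "finite model4"
  by (auto simp: model1_def model2_def model3_def model4_def)

lemma D_finite_model2:
  fixes a b :: "'k::field_char_0"
  shows "D_finite (walk_gf model2 a b)"
proof (cases "a = 0 \<or> b = 0")
  case True
  have "D_finite (1 :: 'k fps)"
    unfolding D_finite_def by (intro exI[of _ 1] exI[of _ "\<lambda>i. if i = 0 then 0 else 1"]) auto
  with True show ?thesis
    by (simp add: walk_gf_eq_1 finite_models)
next
  case False
  then obtain Y where "product_model model2 a b 0 0 0 Y"
    using product_model_exists[OF finite_models(2) _ _ sum_model2] by blast
  then show ?thesis
    by (rule product_model.D_finite_walk_gf) simp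
qed

lemma D_finite_model3:
  fixes a b :: "'k::field_char_0"
  assumes "a \<noteq> 0" "b \<noteq> 0"
  shows "D_finite (walk_gf model3 a b)" "D_finite_ratio (walk_gf model3 a b)"
proof -
  obtain Y where "product_model model3 a b 1 0 0 Y"
    using product_model_exists[OF finite_models(3) assms sum_model3] by blast
  then show "D_finite (walk_gf model3 a b)" "D_finite_ratio (walk_gf model3 a b)"
    by (auto intro: product_model.D_finite_walk_gf product_model.D_finite_ratio_walk_gf)
qed

lemma D_finite_model4:
  fixes a b :: "'k::field_char_0"
  assumes "a \<noteq> 0" "b \<noteq> 0"
  shows "a = 1 \<or> b = 1 \<Longrightarrow> D_finite (walk_gf model4 a b)" "D_finite_ratio (walk_gf model4 a b)"
proof -
  obtain Y where "product_model model4 a b 1 1 1 Y"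
    using product_model_exists[OF finite_models(4) assms sum_model4] by blast
  then show "a = 1 \<or> b = 1 \<Longrightarrow> D_finite (walk_gf model4 a b)" "D_finite_ratio (walk_gf model4 a b)"
    by (auto intro: product_model.D_finite_walk_gf product_model.D_finite_ratio_walk_gf)
qed

section \<open>Model 1\<close>

text \<open>\<open>homog f\<close> is \<open>f (t / z)\<close>.\<close>

definition homog :: "'k::field fps \<Rightarrow> 'k fls fps" where
  "homog f = Abs_fps (\<lambda>n. fls_const (f $ n) * fls_X_inv ^ n)"

lemma homog_nth: "homog f $ n = fls_const (f $ n) * fls_X_inv ^ n"
  by (simp add: homog_def)

lemma homog_add: "homog (f + g) = homog f + homog g"
  by (rule fps_ext) (simp add: homog_nth algebra_simps flip: fls_plus_const)

lemma homog_mult: "homog (f * g) = homog f * homog g"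
proof (rule fps_ext)
  fix n
  have "(homog f * homog g) $ n
      = (\<Sum>i=0..n. fls_const (f $ i * g $ (n - i)) * (fls_X_inv ^ i * fls_X_inv ^ (n - i)))"
    by (simp add: fps_mult_nth homog_nth algebra_simps flip: fls_const_mult_const)
  also have "\<dots> = (\<Sum>i=0..n. fls_const (f $ i * g $ (n - i)) * fls_X_inv ^ n)"
    by (intro sum.cong) (auto simp flip: power_add)
  finally show "homog (f * g) $ n = (homog f * homog g) $ n"
    by (simp add: homog_nth fps_mult_nth fls_const_sum sum_distrib_right)
qed

lemma homog_1: "homog 1 = 1"
  by (rule fps_ext) (simp add: homog_nth)

lemma homog_power: "homog (f ^ n) = homog f ^ n"
  by (induction n) (simp_all add: homog_1 homog_mult)

lemma homog_X: "homog fps_X = fps_X * zinv"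
  by (rule fps_ext) (simp add: homog_nth fps_X_def)

lemma zcoeff_homog: "zcoeff (- 1) (homog f * zvar ^ k) = fps_const (f $ Suc k) * fps_X ^ Suc k"
proof (rule fps_ext)
  fix n
  have "zcoeff (- 1) (homog f * zvar ^ k) $ n = f $ n * (fls_X_inv ^ n * fls_X ^ k) $$ (- 1)"
    by (simp add: fps_const_power homog_nth mult.assoc)
  also have "(fls_X_inv ^ n * fls_X ^ k :: 'a fls) $$ (- 1) = (if n = Suc k then 1 else 0)"
    by (auto simp: fls_X_power_times_conv_shift)
  finally show "zcoeff (- 1) (homog f * zvar ^ k) $ n = (fps_const (f $ Suc k) * fps_X ^ Suc k) $ n"
    by (auto simp del: power_Suc)
qed

text \<open>The pole order of \<open>f (t / z)\<close> at \<open>z = 0\<close> is bounded by the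
  power of \<open>t\<close>, so \<open>z^k\<close> removes all poles up to order \<open>k\<close> in
  \<open>t\<close>.\<close>

lemma homog_regular_nth: "n \<le> k \<Longrightarrow> fls_regular ((homog f * zvar ^ k) $ n)"
proof -
  assume "n \<le> k"
  then have "fls_X_inv ^ n * fls_X ^ k = (fls_X ^ (k - n) :: 'a fls)"
  proof (induction n arbitrary: k)
    case (Suc n)
    then obtain k' where "k = Suc k'" "n \<le> k'"
      by (cases k) auto
    moreover have "fls_X_inv ^ Suc n * fls_X ^ Suc k' = (fls_X_inv * fls_X) * (fls_X_inv ^ n * fls_X ^ k' :: 'a fls)"
      by (simp add: mult_ac)
    moreover have "fls_X_inv * fls_X = (1 :: 'a fls)"
      by (simp add: fls_X_inv_times_conv_shift(1))
    ultimately show ?case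
      using Suc.IH by simp
  qed simp
  then have "(homog f * zvar ^ k) $ n = fls_const (f $ n) * fls_X ^ (k - n)"
    by (simp add: fps_const_power homog_nth mult.assoc)
  moreover have "fls_regular (fls_X ^ m :: 'a fls)" for m
    by (induction m) (use fls_regular_const[of 1] in \<open>auto intro: fls_regular_mult fls_regular_X\<close>)
  ultimately show ?thesis
    by (simp add: fls_regular_mult fls_regular_const)
qed

text \<open>The series \<open>s\<close> is eliminated: \<open>t s ch = (q - cst c) ch - 1\<close>,
  and the equation of \<open>s\<close> multiplied by \<open>t ch^2\<close> involves \<open>s\<close>
  only through \<open>t s ch\<close>. What results is quadratic in \<open>ch\<close>.\<close>

lemma hyperexp_sum_resolvent:
  fixes ch :: "'k::field_char_0 fls fps"
  assumes q: "bipoly q" and s: "q * s = fps_X * (1 + s ^ 2)" and ch: "(q - cst c - fps_X * s) * ch = 1"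
  shows "hyperexp_sum ch"
proof -
  have 1: "fps_X * s * ch = (q - cst c) * ch - 1"
    using ch by (simp add: algebra_simps)
  have "q * ch * (fps_X * s * ch) = fps_X ^ 2 * ch ^ 2 + (fps_X * s * ch) ^ 2"
  proof -
    have "q * ch * (fps_X * s * ch) = fps_X * ch ^ 2 * (q * s)"
      by (simp add: algebra_simps power2_eq_square)
    then show ?thesis
      unfolding s by (simp add: algebra_simps power2_eq_square)
  qed
  then have eq: "(cst c * (q - cst c) - fps_X ^ 2) * ch ^ 2 + (q - 2 * cst c) * ch + - 1 = 0"
    unfolding 1 by (simp add: algebra_simps power2_eq_square)
  have "cst c * (q - cst c) - fps_X ^ 2 \<noteq> 0 \<or> q - 2 * cst c \<noteq> 0"
  proof (rule ccontr)
    assume "\<not> ?thesis"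
    then have z: "cst c * (q - cst c) - fps_X ^ 2 = 0" "q - 2 * cst c = 0"
      by blast+
    \<comment> \<open>With both coefficients zero the equation says \<open>-1 = 0\<close>.\<close>
    show False
      using eq unfolding z by simp
  qed
  then show ?thesis
    by (intro hyperexp_sum_quadratic[OF _ _ _ eq])
       (intro bipoly_diff bipoly_mult bipoly_const bipoly_power bipoly_X bipoly_numeral bipoly_minus bipoly_1 q)+
qed

lemma inverse_mult_zt:
  fixes f :: "'k::field fls fps"
  assumes "f $ 0 $$ k \<noteq> 0"
  shows "f * inverse f = 1"
  by (rule inverse_mult_eq_1') (use assms in auto)

text \<open>
  Without its rank one term at the origin the operator is \<open>1 - X \<otimes> 1 - 1 \<otimes> Y\<close>. Its inverse is the
  contour integral of the resolvent of \<open>X\<close> at \<open>z\<close> times that of \<open>Y\<close> at \<open>1 - z\<close>, along a curve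
  around \<open>0\<close> and the isolated eigenvalue \<open>s0 = \<beta> + t\<^sup>2 / \<beta>\<close> of \<open>X\<close>. Over \<open>K((z))[[t]]\<close> only the
  residue at \<open>0\<close> is visible, so the contribution of \<open>s0\<close>, with eigenvector \<open>ka ^ i\<close>, is added by hand.
\<close>

locale simple_walk =
  fixes a b :: "'k::field_char_0" and y sg0 :: "'k fps" and sg :: "'k fls fps"
  assumes a: "a \<noteq> 0" and b: "b \<noteq> 0" "b \<noteq> 1" and ab: "1 / a + 1 / b \<noteq> 1"
    and y: "y = fps_X * (1 + y ^ 2)"
    and sg0: "(1 - (fps_const (1 - 1 / b) + fps_const (1 / (1 - 1 / b)) * fps_X ^ 2)) * sg0 = fps_X * (1 + sg0 ^ 2)"
    and sg: "(1 - zvar) * sg = fps_X * (1 + sg ^ 2)" and regular_sg: "regular sg"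
begin

definition al :: 'k where "al = 1 - 1 / a"
definition be :: 'k where "be = 1 - 1 / b"
definition ka :: "'k fps" where "ka = fps_const (1 / be) * fps_X"
definition s0 :: "'k fps" where "s0 = fps_const be + ka * fps_X"
definition tau :: "'k fls fps" where "tau = homog y"
text \<open>First column of the resolvent of the horizontal operator at \<open>z\<close>:
  \<open>tau^i\<close> solves the interior rows, and the inverse factor fits the boundary row.
  Likewise \<open>chi\<close> belongs to the vertical operator at \<open>1 - z\<close>, and
  \<open>chi0\<close> is its value for \<open>z = s0\<close>.\<close>

definition phi :: "nat \<Rightarrow> 'k fls fps" where "phi i = tau ^ i * inverse (zvar - cst be - fps_X * tau)"
definition chi :: "nat \<Rightarrow> 'k fls fps" where "chi j = sg ^ j * inverse (1 - zvar - cst al - fps_X * sg)"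
definition chi0 :: "nat \<Rightarrow> 'k fps" where "chi0 j = sg0 ^ j * inverse (1 - s0 - fps_const al - fps_X * sg0)"
text \<open>The eigenvector \<open>ka^i\<close> has squared norm \<open>1 / (1 - ka^2)\<close>, so
  the first summand is the residue of \<open>phi i * chi j\<close> at \<open>z = s0\<close>.\<close>

definition r :: "nat \<Rightarrow> nat \<Rightarrow> 'k fps" where
  "r i j = (1 - ka ^ 2) * ka ^ i * chi0 j + zcoeff (- 1) (phi i * chi j)"

lemma be_nz: "be \<noteq> 0"
  using b by (simp add: be_def)

lemma be_ka: "fps_const be * ka = fps_X"
  using be_nz by (simp add: ka_def fps_const_mult mult.assoc[symmetric])

lemma ka_s0: "s0 * ka = fps_X * (1 + ka ^ 2)"
  using be_ka by (simp add: s0_def power2_eq_square algebra_simps)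

lemma s0_eq: "s0 = fps_const be + fps_const (1 / be) * fps_X ^ 2"
  by (simp add: s0_def ka_def power2_eq_square mult.assoc)

lemma sg0_eq: "(1 - s0) * sg0 = fps_X * (1 + sg0 ^ 2)"
  using sg0 by (simp add: s0_eq be_def)

lemma tau_eq: "zvar * tau = fps_X * (1 + tau ^ 2)"
proof -
  have "tau = fps_X * zinv * (1 + tau ^ 2)"
    unfolding tau_def by (subst y) (simp add: homog_mult homog_X homog_add homog_1 homog_power)
  then have "zvar * tau = zvar * (fps_X * zinv * (1 + tau ^ 2))"
    by simp
  also have "\<dots> = (zvar * zinv) * (fps_X * (1 + tau ^ 2))"
    by (simp add: mult_ac)
  finally show ?thesis
    by (simp add: zvar_zinv)
qed

text \<open>The inverse lives in \<open>K((z))[[t]]\<close>, where \<open>1 / (z - be)\<close> is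
  expanded at \<open>z = 0\<close>; the pole at \<open>s0\<close>, which is \<open>be\<close> for
  \<open>t = 0\<close>, therefore does not contribute to the residue.\<close>

lemma phi_0: "(zvar - cst be - fps_X * tau) * phi 0 = 1"
proof -
  have "(zvar - cst be - fps_X * tau) $ 0 $$ 1 \<noteq> 0"
    by (simp add: mult.assoc)
  from inverse_mult_zt[OF this] show ?thesis
    by (simp add: phi_def)
qed

lemma regular_chi_denom: "regular (1 - zvar - cst al - fps_X * sg)"
  by (intro regular_diff regular_1 regular_zvar regular_const regular_mult regular_X regular_sg)

lemma chi_denom_0: "(1 - zvar - cst al - fps_X * sg) $ 0 $$ 0 \<noteq> 0"
  using a by (simp add: al_def mult.assoc)

lemma chi_0: "(1 - zvar - cst al - fps_X * sg) * chi 0 = 1"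
  unfolding chi_def using inverse_mult_zt[OF chi_denom_0] by simp

lemma regular_chi: "regular (chi j)"
  unfolding chi_def
  by (intro regular_mult regular_power regular_sg regular_inverse regular_chi_denom chi_denom_0)

lemma chi0_0: "(1 - s0 - fps_const al - fps_X * sg0) * chi0 0 = 1"
proof -
  \<comment> \<open>The hypothesis \<open>1/a + 1/b \<noteq> 1\<close> enters here: it makes this
    denominator invertible.\<close>
  have eq: "(1 - s0 - fps_const al - fps_X * sg0) $ 0 = 1 / a + 1 / b - 1"
    by (simp add: s0_def al_def be_def mult.assoc)
  have "(1 - s0 - fps_const al - fps_X * sg0) $ 0 \<noteq> 0"
    unfolding eq using ab by simp
  then show ?thesis
    by (simp add: chi0_def inverse_mult_eq_1')
qed

text \<open>The equation for \<open>s\<close> makes the geometric sequence solve the interior rows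
  with eigenvalue \<open>q\<close>; the condition on \<open>h0\<close> is the row at 0.\<close>

lemma power_recurrence:
  fixes h :: "nat \<Rightarrow> 'r::comm_ring_1"
  assumes "q * s = t * (1 + s ^ 2)" "\<And>i. h i = s ^ i * h0" "(q - c - t * s) * h0 = 1"
  shows "t * (h (Suc i) + (case i of 0 \<Rightarrow> 0 | Suc k \<Rightarrow> h k)) = (q - (if i = 0 then c else 0)) * h i - (if i = 0 then 1 else 0)"
proof (cases i)
  case 0
  then show ?thesis
    using assms(3) by (simp add: assms(2) algebra_simps)
next
  case (Suc k)
  have "t * (h (Suc i) + h k) = (t * (1 + s ^ 2)) * (s ^ k * h0)"
    by (simp add: assms(2) Suc power2_eq_square algebra_simps)
  also have "\<dots> = q * h i"
    by (simp add: assms(2) Suc mult_ac flip: assms(1))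
  finally show ?thesis
    using Suc by simp
qed

lemma residue_tau_power: "zcoeff (- 1) (tau ^ Suc i) = (if i = 0 then fps_X else 0)"
proof -
  have y0: "y $ 0 = 0" "y $ 1 = 1"
    by (subst y, simp add: power2_eq_square)+
  have "zcoeff (- 1) (tau ^ Suc i) = fps_const ((y ^ Suc i) $ 1) * fps_X"
    using zcoeff_homog[of "y ^ Suc i" 0] by (simp add: tau_def homog_power homog_mult)
  also have "(y ^ Suc i) $ 1 = (if i = 0 then 1 else 0)"
    using y0 by (cases i) (simp_all add: fps_mult_nth)
  finally show ?thesis
    by simp
qed

definition nu :: "'k fls fps" where "nu = inverse (zvar - lift s0)"

lemma nu: "(zvar - lift s0) * nu = 1" and regular_nu: "regular nu"
proof -
  have nz: "(zvar - lift s0) $ 0 $$ 0 \<noteq> 0"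
    using be_nz by (simp add: s0_def mult.assoc)
  show "(zvar - lift s0) * nu = 1"
    unfolding nu_def by (rule inverse_mult_zt[OF nz])
  show "regular nu"
    unfolding nu_def by (intro regular_inverse nz regular_diff regular_zvar regular_lift)
qed

text \<open>Expanding \<open>1 / (z - s0)\<close> at 0 shows that the residue of
  \<open>y(t/z) / (z - s0)\<close> is \<open>- y(t/s0)\<close>. Both \<open>y(t/s0)\<close> and
  \<open>ka\<close> solve \<open>u = (t/s0) (1 + u^2)\<close>, which determines
  \<open>u\<close>.\<close>

lemma residue_tau_nu: "zcoeff (- 1) (tau * nu) = - ka"
proof -
  define w where "w = inverse s0"
  have w: "s0 * w = 1"
    unfolding w_def using be_nz by (intro inverse_mult_eq_1') (simp add: s0_def mult.assoc)
  define c where "c k = zcoeff (- 1) (tau * zvar ^ k * nu)" for k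
  have c_Suc: "c (Suc k) = fps_const (y $ Suc k) * fps_X ^ Suc k + s0 * c k" for k
  proof -
    have "tau * zvar ^ Suc k * nu = tau * zvar ^ k * ((zvar - lift s0) * nu) + lift s0 * (tau * zvar ^ k * nu)"
      by (simp add: algebra_simps)
    then show ?thesis
      unfolding c_def nu by (simp add: zcoeff_lift tau_def zcoeff_homog)
  qed
  \<comment> \<open>At order \<open>n\<close> in \<open>t\<close> the remainder of the telescoped
    sum \<open>c_sum\<close> disappears, since \<open>z^n\<close> has removed the poles.\<close>
  have c_small: "c k $ n = 0" if "n \<le> k" for k n
  proof -
    have "fls_regular ((tau * zvar ^ k * nu) $ n)"
      using that regular_nu unfolding tau_def fps_mult_nth[of "homog y * zvar ^ k" nu]
      by (intro fls_regular_sum fls_regular_mult homog_regular_nth) (auto simp: regular_def)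
    then obtain h where "(tau * zvar ^ k * nu) $ n = fps_to_fls h"
      by (auto simp: fls_regular_def)
    then show ?thesis
      by (simp add: c_def)
  qed
  define g where "g = fps_X * w"
  have g0: "g $ 0 = 0"
    by (simp add: g_def)
  have c_sum: "c 0 = w ^ n * c n - (\<Sum>k<n. fps_const (y $ Suc k) * g ^ Suc k)" for n
  proof (induction n)
    case (Suc n)
    have "w ^ Suc n * c (Suc n) = fps_const (y $ Suc n) * g ^ Suc n + w ^ n * (s0 * w) * c n"
      unfolding c_Suc g_def by (simp add: algebra_simps power_mult_distrib)
    then show ?case
      unfolding w using Suc by simp
  qed simp
  have y0: "y $ 0 = 0"
    by (subst y) simp
  have "c 0 = - (y oo g)"
  proof (rule fps_ext)
    fix n
    have "c 0 $ n = (w ^ n * c n) $ n - (\<Sum>k<n. y $ Suc k * g ^ Suc k $ n)"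
      by (subst c_sum[of n]) (simp add: fps_sum_nth)
    also have "(w ^ n * c n) $ n = 0"
      unfolding fps_mult_nth by (simp add: c_small)
    also have "(\<Sum>k<n. y $ Suc k * g ^ Suc k $ n) = (\<Sum>i=0..n. y $ i * g ^ i $ n)"
      using y0 by (simp add: sum.atLeast0_atMost_Suc_shift[symmetric] sum.atLeast_Suc_atMost
          sum.atLeast1_atMost_eq del: power_Suc)
    finally show "c 0 $ n = (- (y oo g)) $ n"
      by (simp add: fps_compose_nth)
  qed
  moreover have "y oo g = ka"
  proof -
    have 1: "y oo g = g * (1 + (y oo g) ^ 2)"
      by (subst y) (simp add: fps_compose_mult_distrib[OF g0] fps_compose_add_distrib
          fps_compose_power[OF g0] g0)
    have "g * (1 + ka ^ 2) = (fps_X * (1 + ka ^ 2)) * w"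
      by (simp add: g_def mult_ac)
    also have "\<dots> = ka * (s0 * w)"
      unfolding ka_s0[symmetric] by (simp add: mult_ac)
    finally have 2: "g * (1 + ka ^ 2) = ka"
      by (simp add: w)
    \<comment> \<open>Difference of the two fixed point equations; its second factor has constant
      term 1, so the first must vanish.\<close>
    have "((y oo g) - ka) * (1 - g * ((y oo g) + ka)) = ((y oo g) - g * (1 + (y oo g) ^ 2)) - (ka - g * (1 + ka ^ 2))"
      by (simp add: algebra_simps power2_eq_square)
    also have "\<dots> = 0"
      using 1 2 by simp
    finally have "(y oo g) - ka = 0 \<or> 1 - g * ((y oo g) + ka) = 0"
      by simp
    moreover have "1 - g * ((y oo g) + ka) \<noteq> 0"
    proof
      assume "1 - g * ((y oo g) + ka) = 0"
      then have "(1 - g * ((y oo g) + ka)) $ 0 = 0"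
        by simp
      then show False
        by (simp add: g0)
    qed
    ultimately show ?thesis
      by simp
  qed
  ultimately show ?thesis
    by (simp add: c_def)
qed

text \<open>Completeness of the spectrum: the residues of the resolvent at \<open>s0\<close> and at
  0 add up to the first column of the identity. The factorisation
  \<open>z - s0 = (1 - ka tau)(z - be - t tau)\<close> gives the case \<open>i = 0\<close>, and a
  recurrence in \<open>i\<close> the others.\<close>

lemma residue_phi: "(1 - ka ^ 2) * ka ^ i + zcoeff (- 1) (phi i) = (if i = 0 then 1 else 0)"
proof -
  define c where "c i = zcoeff (- 1) (phi i)" for i
  have lift_ka: "cst be * lift ka = fps_X"
    using arg_cong[OF be_ka, of lift] by (simp add: lift_mult)
  have "(zvar - lift s0) = (1 - lift ka * tau) * (zvar - cst be - fps_X * tau)"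
  proof -
    have "(1 - lift ka * tau) * (zvar - cst be - fps_X * tau)
        = zvar - cst be - fps_X * tau - lift ka * (zvar * tau) + (cst be * lift ka) * tau
          + lift ka * fps_X * tau ^ 2"
      by (simp add: algebra_simps power2_eq_square)
    also have "\<dots> = zvar - cst be - lift ka * fps_X"
      unfolding tau_eq lift_ka by (simp add: algebra_simps)
    finally show ?thesis
      by (simp add: s0_def lift_add lift_mult)
  qed
  then have "(zvar - lift s0) * phi 0 = (1 - lift ka * tau) * ((zvar - cst be - fps_X * tau) * phi 0)"
    by (simp add: mult_ac)
  then have eq: "(zvar - lift s0) * phi 0 = 1 - lift ka * tau"
    unfolding phi_0 by simp
  have "nu * ((zvar - lift s0) * phi 0) = nu - lift ka * (tau * nu)"
    unfolding eq by (simp add: algebra_simps)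
  moreover have "nu * ((zvar - lift s0) * phi 0) = ((zvar - lift s0) * nu) * phi 0"
    by (simp only: mult_ac)
  ultimately have "phi 0 = nu - lift ka * (tau * nu)"
    by (simp add: nu)
  then have c0: "c 0 = ka ^ 2"
    by (simp add: c_def zcoeff_lift residue_tau_nu zcoeff_regular regular_nu power2_eq_square)
  have c_Suc: "c (Suc i) = ka * c i - (if i = 0 then ka else 0)" for i
  proof -
    have "cst be * phi (Suc i) = fps_X * phi i - tau ^ Suc i"
    proof -
      have "tau ^ Suc i = tau ^ Suc i * ((zvar - cst be - fps_X * tau) * phi 0)"
        by (simp add: phi_0)
      also have "\<dots> = (zvar * tau) * (tau ^ i * phi 0) - cst be * (tau ^ Suc i * phi 0) - fps_X * tau ^ 2 * (tau ^ i * phi 0)"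
        by (simp add: algebra_simps power2_eq_square)
      also have "\<dots> = fps_X * (tau ^ i * phi 0) - cst be * (tau ^ Suc i * phi 0)"
        unfolding tau_eq by (simp add: algebra_simps)
      finally have "tau ^ Suc i = fps_X * phi i - cst be * phi (Suc i)"
        by (simp add: phi_def)
      moreover have "u = v - x" if "x = v - u" for u v x :: "'k fls fps"
        using that by simp
      ultimately show ?thesis
        by blast
    qed
    then have "zcoeff (- 1) (cst be * phi (Suc i)) = zcoeff (- 1) (fps_X * phi i - tau ^ Suc i)"
      by simp
    then have "fps_const be * c (Suc i) = fps_X * c i - (if i = 0 then fps_X else 0)"
      unfolding zcoeff_diff residue_tau_power zcoeff_cst zcoeff_X c_def .
    also have "\<dots> = fps_const be * (ka * c i - (if i = 0 then ka else 0))"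
      unfolding be_ka[symmetric] by (simp add: right_diff_distrib mult.assoc)
    finally show ?thesis
      using be_nz by simp
  qed
  have "c (Suc i) = - (1 - ka ^ 2) * ka ^ Suc i" for i
  proof (induction i)
    case 0
    show ?case
      by (simp add: c_Suc c0 algebra_simps power2_eq_square)
  next
    case (Suc i)
    have "c (Suc (Suc i)) = ka * c (Suc i)"
      using c_Suc[of "Suc i"] by simp
    then show ?case
      unfolding Suc by (simp add: algebra_simps)
  qed
  then have "(1 - ka ^ 2) * ka ^ i + c i = (if i = 0 then 1 else 0)"
    using c0 by (cases i) (auto simp: algebra_simps)
  then show ?thesis
    by (simp add: c_def)
qed

definition N :: "nat \<Rightarrow> nat \<Rightarrow> 'k fps" where
  "N i j = r (Suc i) j + (case i of 0 \<Rightarrow> 0 | Suc k \<Rightarrow> r k j) + r i (Suc j) + (case j of 0 \<Rightarrow> 0 | Suc k \<Rightarrow> r i k)"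

text \<open>Separation of variables: under the residue the horizontal steps act as \<open>z\<close>
  and the vertical ones as \<open>1 - z\<close>, in the isolated term as \<open>s0\<close> and
  \<open>1 - s0\<close>, so in the interior they add up to 1. The source of \<open>phi\<close> is
  lost because \<open>chi j\<close> is regular, and that of \<open>chi\<close> is evaluated by
  \<open>residue_phi\<close>.\<close>

lemma N_eq:
  "fps_X * N i j = (1 - (if i = 0 then fps_const be else 0) - (if j = 0 then fps_const al else 0)) * r i j
     - (if i = 0 \<and> j = 0 then 1 else 0)"
proof -
  define k2 where "k2 = 1 - ka ^ 2"
  have phi: "fps_X * (phi (Suc i) + (case i of 0 \<Rightarrow> 0 | Suc k \<Rightarrow> phi k))
      = (zvar - (if i = 0 then cst be else 0)) * phi i - (if i = 0 then 1 else 0)" for i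
    by (rule power_recurrence[OF tau_eq _ phi_0]) (simp add: phi_def)
  have chi: "fps_X * (chi (Suc j) + (case j of 0 \<Rightarrow> 0 | Suc k \<Rightarrow> chi k))
      = (1 - zvar - (if j = 0 then cst al else 0)) * chi j - (if j = 0 then 1 else 0)" for j
    by (rule power_recurrence[OF sg _ chi_0]) (simp add: chi_def)
  have chi0: "fps_X * (chi0 (Suc j) + (case j of 0 \<Rightarrow> 0 | Suc k \<Rightarrow> chi0 k))
      = (1 - s0 - (if j = 0 then fps_const al else 0)) * chi0 j - (if j = 0 then 1 else 0)" for j
    by (rule power_recurrence[OF sg0_eq _ chi0_0]) (simp add: chi0_def)
  have ka: "fps_X * (ka ^ Suc i + (case i of 0 \<Rightarrow> 0 | Suc k \<Rightarrow> ka ^ k))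
      = (s0 - (if i = 0 then fps_const be else 0)) * ka ^ i" for i
  proof (cases i)
    case 0
    then show ?thesis by (simp add: s0_def mult.commute)
  next
    case (Suc k)
    have "fps_X * (ka ^ Suc i + ka ^ k) = (fps_X * (1 + ka ^ 2)) * ka ^ k"
      using Suc by (simp add: algebra_simps power2_eq_square)
    then show ?thesis
      unfolding ka_s0[symmetric] using Suc by (simp add: mult_ac)
  qed
  have phi_chi: "zcoeff (- 1) (((zvar - (if i = 0 then cst be else 0)) * phi i - (if i = 0 then 1 else 0)) * chi j)
      = zcoeff (- 1) (zvar * phi i * chi j) - (if i = 0 then fps_const be else 0) * zcoeff (- 1) (phi i * chi j)"
  proof (cases "i = 0")
    case True
    have "((zvar - cst be) * phi 0 - 1) * chi j = zvar * phi 0 * chi j - cst be * (phi 0 * chi j) - chi j"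
      by (simp add: algebra_simps)
    then show ?thesis
      using True by (simp add: zcoeff_cst zcoeff_regular regular_chi)
  qed simp
  have chi_phi: "zcoeff (- 1) (phi i * ((1 - zvar - (if j = 0 then cst al else 0)) * chi j - (if j = 0 then 1 else 0)))
      = (1 - (if j = 0 then fps_const al else 0)) * zcoeff (- 1) (phi i * chi j)
        - zcoeff (- 1) (zvar * phi i * chi j) - (if j = 0 then zcoeff (- 1) (phi i) else 0)"
  proof (cases "j = 0")
    case True
    have "phi i * ((1 - zvar - cst al) * chi 0 - 1)
        = phi i * chi 0 - cst al * (phi i * chi 0) - zvar * phi i * chi 0 - phi i"
      by (simp add: algebra_simps)
    then show ?thesis
      using True by (simp add: zcoeff_cst algebra_simps)
  next
    case False
    have "phi i * ((1 - zvar) * chi j) = phi i * chi j - zvar * phi i * chi j"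
      by (simp add: algebra_simps)
    then show ?thesis
      using False by simp
  qed
  have "fps_X * (r (Suc i) j + (case i of 0 \<Rightarrow> 0 | Suc k \<Rightarrow> r k j))
      = k2 * chi0 j * (fps_X * (ka ^ Suc i + (case i of 0 \<Rightarrow> 0 | Suc k \<Rightarrow> ka ^ k)))
        + zcoeff (- 1) (fps_X * (phi (Suc i) + (case i of 0 \<Rightarrow> 0 | Suc k \<Rightarrow> phi k)) * chi j)"
    by (cases i) (simp_all add: r_def k2_def mult.assoc zcoeff_X distrib_right algebra_simps)
  then have X: "fps_X * (r (Suc i) j + (case i of 0 \<Rightarrow> 0 | Suc k \<Rightarrow> r k j))
      = k2 * chi0 j * ((s0 - (if i = 0 then fps_const be else 0)) * ka ^ i)
        + (zcoeff (- 1) (zvar * phi i * chi j) - (if i = 0 then fps_const be else 0) * zcoeff (- 1) (phi i * chi j))"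
    unfolding phi ka phi_chi .
  have "fps_X * (r i (Suc j) + (case j of 0 \<Rightarrow> 0 | Suc k \<Rightarrow> r i k))
      = k2 * ka ^ i * (fps_X * (chi0 (Suc j) + (case j of 0 \<Rightarrow> 0 | Suc k \<Rightarrow> chi0 k)))
        + zcoeff (- 1) (phi i * (fps_X * (chi (Suc j) + (case j of 0 \<Rightarrow> 0 | Suc k \<Rightarrow> chi k))))"
    by (cases j) (simp_all add: r_def k2_def mult.left_commute[of _ fps_X] zcoeff_X distrib_left algebra_simps)
  then have Y: "fps_X * (r i (Suc j) + (case j of 0 \<Rightarrow> 0 | Suc k \<Rightarrow> r i k))
      = k2 * ka ^ i * ((1 - s0 - (if j = 0 then fps_const al else 0)) * chi0 j - (if j = 0 then 1 else 0))
        + ((1 - (if j = 0 then fps_const al else 0)) * zcoeff (- 1) (phi i * chi j)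
        - zcoeff (- 1) (zvar * phi i * chi j) - (if j = 0 then zcoeff (- 1) (phi i) else 0))"
    unfolding chi chi0 chi_phi .
  have "fps_X * N i j = fps_X * (r (Suc i) j + (case i of 0 \<Rightarrow> 0 | Suc k \<Rightarrow> r k j))
      + fps_X * (r i (Suc j) + (case j of 0 \<Rightarrow> 0 | Suc k \<Rightarrow> r i k))"
    by (simp add: N_def algebra_simps)
  also have "\<dots> = (1 - (if i = 0 then fps_const be else 0) - (if j = 0 then fps_const al else 0))
        * (k2 * ka ^ i * chi0 j + zcoeff (- 1) (phi i * chi j))
      - ((if j = 0 then 1 else 0) * (k2 * ka ^ i) + (if j = 0 then zcoeff (- 1) (phi i) else 0))"
  proof -
    have "k2 * c * ((s - e) * p) + (x - e * w) + (k2 * p * ((1 - s - d) * c - u) + ((1 - d) * w - x - v))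
        = (1 - e - d) * (k2 * p * c + w) - (u * (k2 * p) + v)" for c s e p x w d u v :: "'k fps"
      by (simp add: algebra_simps)
    then show ?thesis
      unfolding X Y .
  qed
  also have "(if j = 0 then 1 else 0) * (k2 * ka ^ i) + (if j = 0 then zcoeff (- 1) (phi i) else 0)
      = (if j = 0 then k2 * ka ^ i + zcoeff (- 1) (phi i) else 0)"
    by simp
  also have "(if j = 0 then k2 * ka ^ i + zcoeff (- 1) (phi i) else 0) = (if i = 0 \<and> j = 0 then 1 else 0)"
    unfolding k2_def residue_phi by simp
  finally show ?thesis
    by (simp only: r_def k2_def)
qed

definition R :: "int \<times> int \<Rightarrow> 'k fps" where
  "R = quadrant_ext r"

lemma R_sum: "(\<Sum>s\<in>model1. R ((int i, int j) - s)) = N i j"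
  unfolding R_def model1_def
  by (cases i; cases j)
     (simp_all add: quadrant_ext_def quadrant_def N_def nat_add_distrib algebra_simps)

lemma vertex_weights:
  "fps_const a * (1 - fps_const al) = 1" "fps_const b * (1 - fps_const be) = 1"
  using a b by (simp_all add: al_def be_def ring_distribs fps_const_sub[symmetric] fps_const_mult)

lemma R_eq:
  "R (int i, int j) = (if i = 0 \<and> j = 0
      then fps_const (a * b) * (1 + fps_const (al * be) * r 0 0) else 0) +
    fps_const (vertex_weight a b (int i, int j)) * fps_X * (\<Sum>s\<in>model1. R ((int i, int j) - s))"
proof -
  have val: "R (int i, int j) = r i j"
    by (simp add: R_def quadrant_ext_simps)
  have "r i j = (if i = 0 \<and> j = 0
      then fps_const (a * b) * (1 + fps_const (al * be) * r 0 0) else 0) +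
    fps_const (vertex_weight a b (int i, int j)) * (fps_X * N i j)"
  proof (cases "i = 0"; cases "j = 0")
    assume ij: "i = 0" "j \<noteq> 0"
    then have "fps_const b * (fps_X * N i j) = (fps_const b * (1 - fps_const be)) * r i j"
      by (simp add: N_eq algebra_simps)
    then show ?thesis
      using ij unfolding vertex_weights by (simp add: vertex_weight_def)
  next
    assume ij: "i \<noteq> 0" "j = 0"
    then have "fps_const a * (fps_X * N i j) = (fps_const a * (1 - fps_const al)) * r i j"
      by (simp add: N_eq algebra_simps)
    then show ?thesis
      using ij unfolding vertex_weights by (simp add: vertex_weight_def)
  next
    assume ij: "i \<noteq> 0" "j \<noteq> 0"
    then show ?thesis
      by (simp add: N_eq vertex_weight_def)
  next
    assume ij: "i = 0" "j = 0"
    have "fps_const a * fps_const b * (fps_X * N 0 0)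
        = (fps_const a * (1 - fps_const al)) * (fps_const b * (1 - fps_const be)) * r 0 0
          - fps_const a * fps_const b * (1 + fps_const al * fps_const be * r 0 0)"
      by (simp add: N_eq algebra_simps)
    then have "r 0 0 = fps_const (a * b) * (1 + fps_const (al * be) * r 0 0) + fps_const (a * b) * (fps_X * N 0 0)"
      unfolding vertex_weights fps_const_mult[symmetric] by simp
    then show ?thesis
      using ij by (simp add: vertex_weight_def)
  qed
  then show ?thesis
    unfolding val mult.assoc[of "fps_const (vertex_weight a b (int i, int j))" fps_X] R_sum .
qed

lemma walk_gf_eq: "r 0 0 = fps_const (a * b) * (1 + fps_const (al * be) * r 0 0) * walk_gf model1 a b"
proof -
  have "R (0, 0) = fps_const (a * b) * (1 + fps_const (al * be) * r 0 0) * walk_gf model1 a b"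
  proof (rule walk_gf_unique[OF finite_models(1)])
    fix p :: "int \<times> int"
    show "R p = 0" if "p \<notin> quadrant"
      using that by (simp add: R_def quadrant_ext_def)
    assume "p \<in> quadrant"
    then obtain i j where p: "p = (int i, int j)"
      by (rule quadrant_cases)
    show "R p = (if p = (0, 0) then fps_const (a * b) * (1 + fps_const (al * be) * r 0 0) else 0) +
        fps_const (vertex_weight a b p) * fps_X * (\<Sum>s\<in>model1. R (p - s))"
      unfolding p R_eq[of i j] by simp
  qed
  then show ?thesis
    by (simp add: R_def quadrant_ext_def quadrant_def)
qed

section \<open>D-finiteness for Model 1\<close>

definition f :: "'k fls fps" where
  "f = zinv * lift ((1 - ka ^ 2) * chi0 0) + phi 0 * chi 0"

lemma zcoeff_zinv_1: "zcoeff (- 1) zinv = 1"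
  by (rule fps_ext) simp

lemma r_residue: "r 0 0 = zcoeff (- 1) f"
  unfolding f_def mult.commute[of zinv] by (simp add: r_def zcoeff_lift zcoeff_zinv_1)

lemma hyperexp_sum_zinv: "hyperexp_sum zinv"
  by (rule hyperexp_sum_cancel[of zvar]) (auto simp: zvar_zinv)

lemma hyperexp_sum_f: "hyperexp_sum f"
proof -
  have lift_s0: "lift s0 = cst be + cst (1 / be) * fps_X ^ 2"
    by (simp add: s0_eq lift_add lift_mult lift_power)
  have "hyperexp_sum (lift (chi0 0))"
  proof (rule hyperexp_sum_resolvent)
    show "bipoly (1 - lift s0)"
      unfolding lift_s0
      by (intro bipoly_diff bipoly_add bipoly_mult bipoly_power bipoly_const bipoly_X bipoly_1)
    show "(1 - lift s0) * lift sg0 = fps_X * (1 + lift sg0 ^ 2)"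
      using arg_cong[OF sg0_eq, of lift] by (simp add: lift_mult lift_diff lift_add lift_power)
    show "(1 - lift s0 - cst al - fps_X * lift sg0) * lift (chi0 0) = 1"
      using arg_cong[OF chi0_0, of lift] by (simp add: lift_mult lift_diff)
  qed
  moreover have "hyperexp_sum (lift (1 - ka ^ 2))"
    unfolding ka_def lift_diff lift_power lift_mult lift_const lift_X lift_1
    by (intro hyperexp_sum_bipoly bipoly_diff bipoly_mult bipoly_power bipoly_const bipoly_X bipoly_1)
  moreover have "hyperexp_sum (phi 0)"
    by (rule hyperexp_sum_resolvent[OF bipoly_zvar tau_eq phi_0])
  moreover have "hyperexp_sum (chi 0)"
    by (rule hyperexp_sum_resolvent[OF _ sg chi_0]) (intro bipoly_diff bipoly_1 bipoly_zvar)
  ultimately show ?thesis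
    unfolding f_def lift_mult
    by (intro hyperexp_sum_add hyperexp_sum_mult hyperexp_sum_zinv)
qed

lemma D_finite_ratio_walk_gf: "D_finite_ratio (walk_gf model1 a b)"
proof -
  define H where "H = fps_const (a * b) * (1 + fps_const (al * be) * r 0 0)"
  have F: "D_finite (r 0 0)"
    unfolding r_residue by (rule D_finite_residue[OF hyperexp_sum_f])
  have "H = zcoeff (- 1) (cst (a * b) * (zinv + cst (al * be) * f))"
    by (simp add: H_def zcoeff_cst r_residue zcoeff_zinv_1)
  moreover have "hyperexp_sum (cst (a * b) * (zinv + cst (al * be) * f))"
    by (intro hyperexp_sum_mult hyperexp_sum_add hyperexp_sum_f hyperexp_sum_zinv
        hyperexp_sum_bipoly[OF bipoly_const])
  ultimately have H: "D_finite H"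
    by (simp add: D_finite_residue)
  have eq: "r 0 0 = H * walk_gf model1 a b"
    unfolding H_def by (rule walk_gf_eq)
  \<comment> \<open>If \<open>H\<close> were 0, then so would be \<open>r 0 0\<close>, and
    \<open>H\<close> would equal \<open>a b\<close>.\<close>
  have H_nz: "H \<noteq> 0"
  proof
    assume "H = 0"
    moreover from this have "r 0 0 = 0"
      using eq by simp
    ultimately show False
      using a b by (simp add: H_def)
  qed
  have "fps_to_fls (r 0 0) = fps_to_fls H * fps_to_fls (walk_gf model1 a b)"
    by (subst eq) (rule fls_times_fps_to_fls)
  with H_nz have "fps_to_fls (walk_gf model1 a b) = fps_to_fls (r 0 0) / fps_to_fls H"
    by simp
  with F H H_nz show ?thesis
    unfolding D_finite_ratio_def by blast
qed

lemma D_finite_walk_gf: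
  assumes "a = 1"
  shows "D_finite (walk_gf model1 a b)"
proof -
  have "al = 0"
    unfolding al_def using assms by simp
  with walk_gf_eq have "r 0 0 = fps_const (a * b) * walk_gf model1 a b"
    by simp
  then have "fps_const (1 / (a * b)) * r 0 0 = (fps_const (1 / (a * b)) * fps_const (a * b)) * walk_gf model1 a b"
    by (simp add: mult.assoc)
  also have "fps_const (1 / (a * b)) * fps_const (a * b) = 1"
    using a b by (simp add: fps_const_mult)
  finally have "walk_gf model1 a b = zcoeff (- 1) (cst (1 / (a * b)) * f)"
    by (simp only: zcoeff_cst r_residue mult_1)
  moreover have "hyperexp_sum (cst (1 / (a * b)) * f)"
    by (intro hyperexp_sum_mult hyperexp_sum_f hyperexp_sum_bipoly bipoly_const)
  ultimately show ?thesis
    by (simp add: D_finite_residue)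
qed

end

lemma simple_walk_exists:
  fixes a b :: "'k::field_char_0"
  assumes "a \<noteq> 0" "b \<noteq> 0" "b \<noteq> 1" "1 / a + 1 / b \<noteq> 1"
  shows "\<exists>y sg0 sg. simple_walk a b y sg0 sg"
proof -
  obtain y :: "'k fps" where y: "y = fps_X * (1 + 0 * y + 1 * y ^ 2)"
    using quadratic_fixpoint_exists[of 1 UNIV 0 1] by auto
  define s where "s = fps_const (1 - 1 / b) + fps_const (1 / (1 - 1 / b)) * fps_X ^ 2"
  have s: "(1 - s) * inverse (1 - s) = 1"
    using assms by (intro inverse_mult_eq_1') (simp add: s_def)
  obtain sg0 :: "'k fps" where sg0: "sg0 = fps_X * (inverse (1 - s) + 0 * sg0 + inverse (1 - s) * sg0 ^ 2)"
    using quadratic_fixpoint_exists[of "inverse (1 - s)" UNIV 0 "inverse (1 - s)"] by auto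
  have "(1 - s) * sg0 = (1 - s) * (fps_X * (inverse (1 - s) + 0 * sg0 + inverse (1 - s) * sg0 ^ 2))"
    using sg0 by simp
  also have "\<dots> = ((1 - s) * inverse (1 - s)) * (fps_X * (1 + sg0 ^ 2))"
    by (simp add: algebra_simps)
  finally have sg0': "(1 - s) * sg0 = fps_X * (1 + sg0 ^ 2)"
    by (simp add: s)
  define u :: "'k fls fps" where "u = inverse (1 - zvar)"
  have u: "(1 - zvar) * u = 1" and "regular u"
    unfolding u_def
    by (rule inverse_mult_zt[of _ 0], simp)
       (intro regular_inverse regular_diff regular_1 regular_zvar, simp)
  \<comment> \<open>The invariant set of the fixed point keeps \<open>sg\<close> free of poles at
    \<open>z = 0\<close>.\<close>
  then obtain sg :: "'k fls fps" where sg: "sg = fps_X * (u + 0 * sg + u * sg ^ 2)"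
      and reg: "\<forall>n. sg $ n \<in> Collect fls_regular"
    using quadratic_fixpoint_exists[of u "Collect fls_regular" 0 u]
    by (auto simp: regular_def fls_regular_0 fls_regular_add fls_regular_mult)
  have "(1 - zvar) * sg = (1 - zvar) * (fps_X * (u + 0 * sg + u * sg ^ 2))"
    using sg by simp
  also have "\<dots> = ((1 - zvar) * u) * (fps_X * (1 + sg ^ 2))"
    by (simp add: algebra_simps)
  finally have sg': "(1 - zvar) * sg = fps_X * (1 + sg ^ 2)"
    by (simp add: u)
  have "simple_walk a b y sg0 sg"
    using assms y sg0' sg' reg by unfold_locales (auto simp: s_def regular_def)
  then show ?thesis
    by blast
qed

lemma D_finite_ratio_model1:
  fixes a b :: "'k::field_char_0"
  assumes "a \<noteq> 0" "b \<noteq> 0" "b \<noteq> 1" "1 / a + 1 / b \<noteq> 1"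
  shows "D_finite_ratio (walk_gf model1 a b)"
  using simple_walk_exists[OF assms] simple_walk.D_finite_ratio_walk_gf by blast

lemma D_finite_model1:
  fixes b :: "'k::field_char_0"
  assumes "b \<noteq> 0" "b \<noteq> 1"
  shows "D_finite (walk_gf model1 1 b)" "D_finite (walk_gf model1 b 1)"
proof -
  obtain y sg0 sg where "simple_walk 1 b y sg0 sg"
    using simple_walk_exists[of 1 b] assms by auto
  then show "D_finite (walk_gf model1 1 b)"
    by (rule simple_walk.D_finite_walk_gf) simp
  moreover have "prod.swap ` model1 = model1"
    by (auto simp: model1_def)
  ultimately show "D_finite (walk_gf model1 b 1)"
    using walk_gf_swap[OF finite_models(1)] by metis
qed

section \<open>Indeterminate weights\<close>

lemma indet_neq: "indet \<noteq> 0" "indet \<noteq> 1" "indet_a \<noteq> 0" "indet_b \<noteq> 0" "indet_b \<noteq> 1"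
  by (simp_all add: indet_def indet_a_def indet_b_def Zero_fract_def One_fract_def eq_fract one_pCons)

lemma indet_inverse_sum: "1 / indet_a + 1 / indet_b \<noteq> 1"
proof
  assume "1 / indet_a + 1 / indet_b = 1"
  then have "indet_a + indet_b = indet_a * indet_b"
    using indet_neq by (simp add: field_simps)
  then show False
    by (simp add: indet_a_def indet_b_def eq_fract)
qed

theorem theorem1:
  shows "(\<forall>S \<in> {model1, model3, model4}.
            D_finite_ratio (walk_gf S indet_a indet_b) \<and>
            D_finite (walk_gf S indet 1) \<and>
            D_finite (walk_gf S 1 indet)) \<and>
         D_finite (walk_gf model2 indet_a indet_b) \<and>
         (\<forall>a b :: complex. D_finite (walk_gf model2 a b))"
  using indet_neq indet_inverse_sum
  by (auto intro: D_finite_ratio_model1 D_finite_model1 D_finite_model2 D_finite_model3 D_finite_model4)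

end
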